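(* Let $H$ be an $\aleph_1$-free group. Then $H$ is n-slender, cm-slender, and lcH-slender. In particular, every abstract group homomorphism from a completely metrizable topological group to $H$ has open kernel, and every abstract group homomorphism from a locally compact Hausdorff topological group to $H$ has open kernel.
   Context: A group is $\aleph_1$-free if every countable subgroup (equivalently, every subgroup generated by fewer than $\aleph_1$ elements) is a free group. A group $H$ is cm-slender if every abstract homomorphism from a completely metrizable topological group to $H$ has open kernel; $H$ is lcH-slender if every abstract homomorphism from a locally compact Hausdorff topological group to $H$ has open kernel. The Hawaiian earring group $\mathcal{H}$: fix letters $\{a_n^{\pm1}\}_{n\in\omega}$. A word is a function $W:\overline{W}\to\{a_n^{\pm1}\}_{n\in\omega}$ whose domain $\overline{W}$ is a totally ordered set such that for each $m$ the preimage $W^{-1}(\{a_n^{\pm1}\}_{n=0}^m)$ is finite; words are identified up to order isomorphism of domains preserving letters. For $m\in\omega$, $p_m(W)$ is the restriction of $W$ to $\{i: W(i)\in\{a_n^{\pm1}\}_{n=0}^m\}$, a finite word. Two words $W,U$ are equivalent if for every $m$, $p_m(W)$ and $p_m(U)$ are equal in the free group $F(a_0,\dots,a_m)$. $\mathcal{H}$ is the set of equivalence classes with multiplication induced by concatenation (ordered disjoint union of domains, first word below second) and inverse induced by reversing the order and inverting letters. $p_m$ induces a retraction homomorphism $p_m:\mathcal{H}\to\mathcal{H}_m$ onto the subgroup $\mathcal{H}_m\cong F(a_0,\dots,a_m)$ of classes of finite words in $a_0,\dots,a_m$. $\mathcal{H}^m$ denotes the subgroup of elements having a representative word using no letter from $\{a_n^{\pm1}\}_{n=0}^m$.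 A group $H$ is n-slender if for every homomorphism $\phi:\mathcal{H}\to H$ there is $m\in\omega$ with $\phi=\phi\circ p_m$, equivalently $\mathcal{H}^m\le\ker\phi$. *)

theory Defs
  imports "HOL-Analysis.Analysis" "HOL-Algebra.Algebra"
begin

text \<open>A letter is a pair (generator, inverted?).  Two letters cancel if they
  have the same generator and opposite exponents.\<close>

definition cancels :: "'a \<times> bool \<Rightarrow> 'a \<times> bool \<Rightarrow> bool" where
  "cancels l l' \<longleftrightarrow> fst l = fst l' \<and> snd l \<noteq> snd l'"

definition reduced_word :: "('a \<times> bool) list \<Rightarrow> bool" where
  "reduced_word w \<longleftrightarrow> (\<forall>i. Suc i < length w \<longrightarrow> \<not> cancels (w ! i) (w ! Suc i))"

definition reduce_word :: "('a \<times> bool) list \<Rightarrow> ('a \<times> bool) list" where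
  "reduce_word w = foldr (\<lambda>l acc. case acc of [] \<Rightarrow> [l]
       | l' # acc' \<Rightarrow> (if cancels l l' then acc' else l # acc)) w []"

definition eval_word :: "('a, 'm) monoid_scheme \<Rightarrow> ('a \<times> bool) list \<Rightarrow> 'a" where
  "eval_word G w = foldr (\<lambda>l acc. (if snd l then inv\<^bsub>G\<^esub> (fst l) else fst l) \<otimes>\<^bsub>G\<^esub> acc) w \<one>\<^bsub>G\<^esub>"

definition free_group :: "('a, 'm) monoid_scheme \<Rightarrow> bool" where
  "free_group G \<longleftrightarrow> group G \<and> (\<exists>B. B \<subseteq> carrier G \<and> generate G B = carrier G \<and>
      (\<forall>w. w \<noteq> [] \<and> reduced_word w \<and> fst ` set w \<subseteq> B \<longrightarrow> eval_word G w \<noteq> \<one>\<^bsub>G\<^esub>))"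

definition aleph1_free :: "('a, 'm) monoid_scheme \<Rightarrow> bool" where
  "aleph1_free H \<longleftrightarrow> group H \<and>
     (\<forall>S. subgroup S H \<and> countable S \<longrightarrow> free_group (H\<lparr>carrier := S\<rparr>))"

text \<open>Letters a_n^{\<pm>1} are pairs (n, inverted?).  A (transfinite) word is a
  map W from a totally ordered domain D; since such domains are countable
  (union of finite sets) we take D to be a subset of the rationals, every countable
  linear order embedding into \<rat>.\<close>

definition HE_word :: "rat set \<Rightarrow> (rat \<Rightarrow> nat \<times> bool) \<Rightarrow> bool" where
  "HE_word D W \<longleftrightarrow> (\<forall>m. finite {i \<in> D. fst (W i) \<le> m})"

definition HE_proj :: "nat \<Rightarrow> rat set \<Rightarrow> (rat \<Rightarrow> nat \<times> bool) \<Rightarrow> (nat \<times> bool) list" where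
  "HE_proj m D W = map W (sorted_list_of_set {i \<in> D. fst (W i) \<le> m})"

text \<open>An element of the Hawaiian earring group (an equivalence class of words)
  is represented faithfully by the sequence of reduced forms of its
  projections p_m(W) in F(a_0..a_m): two words are equivalent exactly when these
  sequences agree.  Multiplication (induced by concatenation) is computed
  componentwise in the free groups.\<close>
definition HE_carrier :: "(nat \<Rightarrow> (nat \<times> bool) list) set" where
  "HE_carrier = {f. \<exists>D W. HE_word D W \<and> (\<forall>m. f m = reduce_word (HE_proj m D W))}"

definition HE :: "(nat \<Rightarrow> (nat \<times> bool) list) monoid" where
  "HE = \<lparr>carrier = HE_carrier,
         mult = (\<lambda>f g m. reduce_word (f m @ g m)),
         one = (\<lambda>m. [])\<rparr>"

text \<open>The retraction p_m : HE \<rightarrow> HE_m; p_k(p_m(W)) = p_{min k m}(W).\<close>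
definition HE_retr :: "nat \<Rightarrow> (nat \<Rightarrow> (nat \<times> bool) list) \<Rightarrow> (nat \<Rightarrow> (nat \<times> bool) list)" where
  "HE_retr m f = (\<lambda>k. f (min k m))"

definition n_slender :: "('a, 'm) monoid_scheme \<Rightarrow> bool" where
  "n_slender H \<longleftrightarrow> (\<forall>\<phi> \<in> hom HE H. \<exists>m. \<forall>x \<in> carrier HE. \<phi> x = \<phi> (HE_retr m x))"

definition topological_group :: "'b monoid \<Rightarrow> 'b topology \<Rightarrow> bool" where
  "topological_group G T \<longleftrightarrow> group G \<and> topspace T = carrier G \<and>
     continuous_map (prod_topology T T) T (\<lambda>(x, y). x \<otimes>\<^bsub>G\<^esub> y) \<and>
     continuous_map T T (\<lambda>x. inv\<^bsub>G\<^esub> x)"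

definition cm_slender :: "'b itself \<Rightarrow> ('a, 'm) monoid_scheme \<Rightarrow> bool" where
  "cm_slender _ H \<longleftrightarrow> (\<forall>(G :: 'b monoid) T \<phi>.
      topological_group G T \<and> completely_metrizable_space T \<and> \<phi> \<in> hom G H
        \<longrightarrow> openin T (kernel G H \<phi>))"

definition lcH_slender :: "'b itself \<Rightarrow> ('a, 'm) monoid_scheme \<Rightarrow> bool" where
  "lcH_slender _ H \<longleftrightarrow> (\<forall>(G :: 'b monoid) T \<phi>.
      topological_group G T \<and> locally_compact_space T \<and> Hausdorff_space T \<and> \<phi> \<in> hom G H
        \<longrightarrow> openin T (kernel G H \<phi>))"

end

theory Submission
  imports Defs
begin

text \<open>A homomorphism \<open>\<phi>\<close> from a (suitably complete) group to \<open>H\<close> that is nontrivial arbitrarily close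
  to \<open>1\<close> yields \<open>g\<^sub>n \<rightarrow> 1\<close> with \<open>h\<^sub>n = \<phi>(g\<^sub>n) \<noteq> 1\<close>. Completeness solves infinite systems of equations in
  the \<open>g\<^sub>n\<close>, and each system is transported to a countable, hence free, subgroup of \<open>H\<close>.

  First system: \<open>x\<^sub>n = x\<^sub>n\<^sub>+\<^sub>1 h\<^sub>n x\<^sub>n\<^sub>+\<^sub>1\<^sup>-\<^sup>1 h\<^sub>n\<^sup>4\<close>. If \<open>b a b\<^sup>-\<^sup>1 a\<^sup>4\<close> lies in a free factor spanned by basis
  elements and \<open>a \<noteq> 1\<close>, then \<open>a\<close> and \<open>b\<close> lie in it too. Hence all \<open>h\<^sub>n\<close> lie in the finitely generated
  free factor carrying \<open>x\<^sub>0\<close>, and their lengths in any larger countable subgroup are controlled, up to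
  a constant factor, by lengths \<open>N\<^sub>n\<close> that are known beforehand.

  Second system (Dudley): \<open>w\<^sub>n = h\<^sub>n w\<^sub>n\<^sub>+\<^sub>1\<^sup>k\<close> for a subsequence of the \<open>h\<^sub>n\<close>, with \<open>k\<close> growing faster than any
  multiple of \<open>N\<^sub>n\<close>. Powers in a free group are at least as long as their exponent, so the lengths of
  the \<open>w\<^sub>n\<close> eventually decrease strictly for ever, which is absurd.\<close>

section \<open>Words\<close>

definition flip :: "'a \<times> bool \<Rightarrow> 'a \<times> bool" where
  "flip l = (fst l, \<not> snd l)"

definition inv_word :: "('a \<times> bool) list \<Rightarrow> ('a \<times> bool) list" where
  "inv_word w = map flip (rev w)"

definition push :: "'a \<times> bool \<Rightarrow> ('a \<times> bool) list \<Rightarrow> ('a \<times> bool) list" where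
  "push l w = (case w of [] \<Rightarrow> [l] | l' # w' \<Rightarrow> if cancels l l' then w' else l # w)"

lemma cancels_iff_flip: "cancels l l' \<longleftrightarrow> l' = flip l"
  by (cases l; cases l') (auto simp: cancels_def flip_def)

lemma flip_flip [simp]: "flip (flip l) = l"
  by (simp add: flip_def)

lemma fst_flip [simp]: "fst (flip l) = fst l"
  by (simp add: flip_def)

lemma flip_neq [simp]: "flip l \<noteq> l" "l \<noteq> flip l"
  by (cases l; simp add: flip_def)+

lemma flip_eq_flip_iff [simp]: "flip l = flip l' \<longleftrightarrow> l = l'"
  by (metis flip_flip)

lemma inv_word_Nil [simp]: "inv_word [] = []"
  and inv_word_Cons [simp]: "inv_word (l # w) = inv_word w @ [flip l]"
  and inv_word_append [simp]: "inv_word (u @ v) = inv_word v @ inv_word u"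
  and inv_word_inv_word [simp]: "inv_word (inv_word w) = w"
  and length_inv_word [simp]: "length (inv_word w) = length w"
  and fst_set_inv_word [simp]: "fst ` set (inv_word w) = fst ` set w"
  by (auto simp: inv_word_def rev_map comp_def image_image)

lemma inv_word_eq_Nil_iff [simp]: "inv_word w = [] \<longleftrightarrow> w = []"
  by (simp add: inv_word_def)

lemma filter_inv_word:
  "filter (\<lambda>l. P (fst l)) (inv_word w) = inv_word (filter (\<lambda>l. P (fst l)) w)"
  by (induction w) auto

lemma last_inv_word: "w \<noteq> [] \<Longrightarrow> last (inv_word w) = flip (hd w)"
  by (simp add: inv_word_def last_map last_rev)

lemma reduced_word_iff_successively:
  "reduced_word w \<longleftrightarrow> successively (\<lambda>l l'. l' \<noteq> flip l) w"
  by (simp add: reduced_word_def successively_conv_nth cancels_iff_flip less_diff_conv)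

lemma reduced_word_Nil [simp]: "reduced_word []"
  by (simp add: reduced_word_def)

lemma reduced_word_single [simp]: "reduced_word [l]"
  by (simp add: reduced_word_def)

lemma reduced_word_Cons_iff:
  "reduced_word (l # w) \<longleftrightarrow> reduced_word w \<and> (w = [] \<or> hd w \<noteq> flip l)"
  by (auto simp: reduced_word_iff_successively successively_Cons)

lemma reduced_word_append_iff:
  "reduced_word (u @ v) \<longleftrightarrow>
     reduced_word u \<and> reduced_word v \<and> (u = [] \<or> v = [] \<or> hd v \<noteq> flip (last u))"
  by (auto simp: reduced_word_iff_successively successively_append_iff)

lemma reduced_inv_word [simp]: "reduced_word (inv_word w) \<longleftrightarrow> reduced_word w"
proof -
  have "reduced_word (inv_word w)" if "reduced_word w" for w :: "('a \<times> bool) list"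
    using that
    by (induction w)
      (auto simp: reduced_word_append_iff reduced_word_Cons_iff last_inv_word)
  from this[of w] this[of "inv_word w"] show ?thesis by auto
qed

lemma reduce_word_foldr: "reduce_word w = foldr push w []"
  by (simp add: reduce_word_def push_def[abs_def])

lemma reduced_push: "reduced_word w \<Longrightarrow> reduced_word (push l w)"
  by (auto simp: push_def cancels_iff_flip reduced_word_Cons_iff split: list.splits)

lemma reduced_foldr_push: "reduced_word w \<Longrightarrow> reduced_word (foldr push u w)"
  by (induction u) (auto intro: reduced_push)

lemma push_flip_push: "reduced_word w \<Longrightarrow> push (flip l) (push l w) = w"
  by (auto simp: push_def cancels_iff_flip reduced_word_Cons_iff split: list.splits)

lemma push_push_flip: "reduced_word w \<Longrightarrow> push l (push (flip l) w) = w"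
  using push_flip_push[of w "flip l"] by simp

text \<open>Van der Waerden's trick: on reduced words, pushing \<open>l\<close> and pushing
  \<open>flip l\<close> are mutually inverse, so words act by permutations of the reduced words. The
  cancelling case of \<open>push l u\<close> is exactly this inverse law, and no confluence argument
  is needed.\<close>

lemma foldr_push_push:
  assumes "reduced_word w"
  shows "foldr push (push l u) w = push l (foldr push u w)"
  using assms reduced_foldr_push[OF assms]
  by (auto simp: push_def[of l u] cancels_iff_flip push_push_flip split: list.splits)

lemma foldr_push_reduce_word:
  "reduced_word w \<Longrightarrow> foldr push (reduce_word u) w = foldr push u w"
  by (induction u) (auto simp: reduce_word_foldr foldr_push_push)

lemma reduced_reduce_word [simp]: "reduced_word (reduce_word w)"
  by (simp add: reduce_word_foldr reduced_foldr_push)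

lemma reduce_word_reduced: "reduced_word w \<Longrightarrow> reduce_word w = w"
  by (induction w)
    (auto simp: reduce_word_foldr push_def cancels_iff_flip reduced_word_Cons_iff
       split: list.splits)

lemma reduce_word_append: "reduce_word (u @ v) = foldr push u (reduce_word v)"
  by (simp add: reduce_word_foldr)

lemma reduce_word_reduce_append [simp]:
  "reduce_word (reduce_word u @ v) = reduce_word (u @ v)"
  "reduce_word (u @ reduce_word v) = reduce_word (u @ v)"
  by (simp_all add: reduce_word_append foldr_push_reduce_word reduce_word_reduced)

lemma foldr_push_inv_word:
  "reduced_word w \<Longrightarrow> foldr push (inv_word u) (foldr push u w) = w"
  by (induction u) (simp_all add: push_flip_push reduced_foldr_push)

lemma reduce_word_inv_append [simp]: "reduce_word (inv_word u @ u) = []"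
  using foldr_push_inv_word[of "[]" u] by (simp add: reduce_word_foldr)

lemma set_reduce_word: "set (reduce_word w) \<subseteq> set w"
proof (induction w)
  case (Cons l w)
  have "set (push l v) \<subseteq> insert l (set v)" for v
    by (auto simp: push_def split: list.splits)
  with Cons show ?case
    by (fastforce simp: reduce_word_foldr)
qed (simp add: reduce_word_def)

section \<open>Cyclically reduced cores and powers\<close>

lemma reduced_word_conjugate_form:
  assumes "reduced_word w" "w \<noteq> []"
  shows "\<exists>u d. w = u @ d @ inv_word u \<and> d \<noteq> [] \<and> hd d \<noteq> flip (last d)"
  using assms
proof (induction "length w" arbitrary: w rule: less_induct)
  case less
  show ?case
  proof (cases "hd w = flip (last w)")
    case False
    then show ?thesis using less by (intro exI[of _ "[]"] exI[of _ w]) auto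
  next
    case True
    obtain l w' where w: "w = l # w'" using less by (cases w) auto
    have "w' \<noteq> []" using True w by auto
    then obtain v l' where v: "w' = v @ [l']" by (metis rev_exhaust)
    have l': "l' = flip l" using True w v by auto
    have "v \<noteq> []" using less.prems l' w v by (auto simp: reduced_word_Cons_iff)
    moreover have "reduced_word v"
      using less.prems w v by (auto simp: reduced_word_Cons_iff reduced_word_append_iff)
    ultimately obtain u d where "v = u @ d @ inv_word u" "d \<noteq> []" "hd d \<noteq> flip (last d)"
      using less.hyps[of v] w v by auto
    then show ?thesis
      by (intro exI[of _ "l # u"] exI[of _ d]) (simp add: w v l')
  qed
qed

lemma reduced_word_replicate:
  assumes "reduced_word d" "d \<noteq> []" "hd d \<noteq> flip (last d)"
  shows "reduced_word (concat (replicate n d))"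
proof (induction n)
  case (Suc n)
  have "concat (replicate n d) = [] \<or> hd (concat (replicate n d)) = hd d"
    using assms by (cases n) auto
  then show ?case using Suc assms by (auto simp: reduced_word_append_iff)
qed simp

lemma reduced_word_conjugate_power:
  assumes "reduced_word (u @ d @ inv_word u)" "d \<noteq> []" "hd d \<noteq> flip (last d)" "n > 0"
  shows "reduced_word (u @ concat (replicate n d) @ inv_word u)"
proof -
  obtain m where m: "n = Suc m" using assms by (cases n) auto
  have d: "reduced_word d" using assms by (auto simp: reduced_word_append_iff)
  let ?D = "concat (replicate n d)"
  have "?D \<noteq> []" "hd ?D = hd d" "last ?D = last d"
  proof -
    show "?D \<noteq> []" "hd ?D = hd d" using m assms by auto
    have "?D = concat (replicate m d) @ d"
      unfolding m replicate_append_same[symmetric] replicate_Suc by simp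
    then show "last ?D = last d" using assms by simp
  qed
  then show ?thesis
    using assms reduced_word_replicate[OF d assms(2,3)] by (auto simp: reduced_word_append_iff)
qed

section \<open>Length functions of free groups\<close>

context group begin

lemma inv_mult_cancel [simp]:
  assumes "a \<in> carrier G" "b \<in> carrier G"
  shows "inv a \<otimes> (a \<otimes> b) = b" "a \<otimes> (inv a \<otimes> b) = b"
  using assms by (simp_all flip: m_assoc)

lemma conj_eq_one_iff:
  assumes "g \<in> carrier G" "m \<in> carrier G"
  shows "inv g \<otimes> m \<otimes> g = \<one> \<longleftrightarrow> m = \<one>"
proof
  assume "inv g \<otimes> m \<otimes> g = \<one>"
  then have "g \<otimes> (inv g \<otimes> m \<otimes> g) = g" using assms by simp
  then have "m \<otimes> g = g"
    using assms by (simp add: m_assoc[symmetric])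
  then show "m = \<one>" using assms by simp
qed (use assms in simp)

lemma eval_word_Nil [simp]: "eval_word G [] = \<one>"
  by (simp add: eval_word_def)

lemma eval_word_Cons:
  "eval_word G (l # w) = (if snd l then inv (fst l) else fst l) \<otimes> eval_word G w"
  by (simp add: eval_word_def)

lemma eval_word_closed [simp, intro]:
  "fst ` set w \<subseteq> carrier G \<Longrightarrow> eval_word G w \<in> carrier G"
  by (induction w) (auto simp: eval_word_Cons)

lemma eval_word_append:
  "fst ` set u \<subseteq> carrier G \<Longrightarrow> fst ` set v \<subseteq> carrier G \<Longrightarrow>
     eval_word G (u @ v) = eval_word G u \<otimes> eval_word G v"
  by (induction u) (auto simp: eval_word_Cons m_assoc)

lemma eval_word_inv_word:
  "fst ` set w \<subseteq> carrier G \<Longrightarrow> eval_word G (inv_word w) = inv (eval_word G w)"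
proof (induction w)
  case (Cons l w)
  have "eval_word G [flip l] = inv (if snd l then inv (fst l) else fst l)"
    using Cons.prems by (simp add: eval_word_Cons flip_def)
  with Cons show ?case
    by (simp add: eval_word_append eval_word_Cons inv_mult_group)
qed simp

lemma eval_word_push:
  assumes "fst ` set (l # w) \<subseteq> carrier G"
  shows "eval_word G (push l w) = eval_word G (l # w)"
proof (cases w)
  case (Cons l' w')
  have "eval_word G w' = eval_word G (l # flip l # w')"
    using assms Cons by (simp add: eval_word_Cons flip_def m_assoc[symmetric])
  then show ?thesis
    using Cons by (auto simp: push_def cancels_iff_flip)
qed (simp add: push_def)

lemma eval_word_reduce_word:
  "fst ` set w \<subseteq> carrier G \<Longrightarrow> eval_word G (reduce_word w) = eval_word G w"
proof (induction w)
  case (Cons l w)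
  have "fst ` set (reduce_word w) \<subseteq> carrier G"
    using Cons.prems set_reduce_word[of w] by auto
  moreover have "reduce_word (l # w) = push l (reduce_word w)"
    by (simp add: reduce_word_foldr)
  ultimately show ?case
    using Cons by (simp add: eval_word_push eval_word_Cons)
qed (simp add: reduce_word_def)

lemma eval_word_replicate:
  "fst ` set d \<subseteq> carrier G \<Longrightarrow>
     eval_word G (concat (replicate n d)) = eval_word G d [^] n"
proof (induction n)
  case (Suc n)
  then show ?case
    by (subst nat_pow_Suc2) (auto simp: eval_word_append image_subset_iff)
qed simp

lemma generate_eq_eval_word:
  assumes "A \<subseteq> carrier G"
  shows "generate G A = eval_word G ` {w. fst ` set w \<subseteq> A}"
proof
  show "generate G A \<subseteq> eval_word G ` {w. fst ` set w \<subseteq> A}"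
  proof
    fix x assume "x \<in> generate G A"
    then show "x \<in> eval_word G ` {w. fst ` set w \<subseteq> A}"
    proof (induction rule: generate.induct)
      case one
      show ?case by (rule image_eqI[of _ _ "[]"]) auto
    next
      case (incl h)
      then show ?case
        using assms by (intro image_eqI[of _ _ "[(h, False)]"]) (auto simp: eval_word_Cons)
    next
      case (inv h)
      then show ?case
        using assms by (intro image_eqI[of _ _ "[(h, True)]"]) (auto simp: eval_word_Cons)
    next
      case (eng h1 h2)
      then obtain w1 w2 where "fst ` set w1 \<subseteq> A" "fst ` set w2 \<subseteq> A"
        "h1 = eval_word G w1" "h2 = eval_word G w2" by auto
      then show ?case
        using assms by (intro image_eqI[of _ _ "w1 @ w2"]) (auto simp: eval_word_append)
    qed
  qed
  show "eval_word G ` {w. fst ` set w \<subseteq> A} \<subseteq> generate G A"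
  proof clarify
    fix w :: "('a \<times> bool) list" assume "fst ` set w \<subseteq> A"
    then show "eval_word G w \<in> generate G A"
      by (induction w) (auto simp: eval_word_Cons intro: generate.intros)
  qed
qed

lemma countable_generate:
  assumes "A \<subseteq> carrier G" "countable A"
  shows "countable (generate G A)"
proof -
  have "{w. fst ` set w \<subseteq> A} \<subseteq> lists (A \<times> (UNIV :: bool set))"
    by force
  moreover have "countable (lists (A \<times> (UNIV :: bool set)))"
    using assms by (intro countable_lists) auto
  ultimately show ?thesis
    unfolding generate_eq_eval_word[OF assms(1)] by (meson countable_image countable_subset)
qed

end

section \<open>Common prefixes and letter counts\<close>

fun lcp :: "'a list \<Rightarrow> 'a list \<Rightarrow> 'a list" where
  "lcp (x # u) (y # v) = (if x = y then x # lcp u v else [])"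
| "lcp _ _ = []"

lemma lcp_split:
  "\<exists>s t. u = lcp u v @ s \<and> v = lcp u v @ t \<and> (s = [] \<or> t = [] \<or> hd s \<noteq> hd t)"
  by (induction u v rule: lcp.induct) auto

definition weight :: "'a set \<Rightarrow> ('a \<times> bool) list \<Rightarrow> nat" where
  "weight T w = length (filter (\<lambda>l. fst l \<in> T) w)"

lemma weight_Nil [simp]: "weight T [] = 0"
  and weight_Cons: "weight T (l # w) = (if fst l \<in> T then 1 else 0) + weight T w"
  and weight_append [simp]: "weight T (u @ v) = weight T u + weight T v"
  by (auto simp: weight_def)

lemma weight_inv_word [simp]: "weight T (inv_word w) = weight T w"
  by (simp add: weight_def filter_inv_word[where P = "\<lambda>x. x \<in> T"])

lemma weight_replicate [simp]: "weight T (concat (replicate n w)) = n * weight T w"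
  by (induction n) auto

lemma weight_push: "weight T (push l w) \<le> weight T (l # w)"
  by (auto simp: push_def weight_Cons split: list.splits)

lemma weight_reduce_word: "weight T (reduce_word w) \<le> weight T w"
proof (induction w)
  case (Cons l w)
  have "weight T (reduce_word (l # w)) \<le> weight T (l # reduce_word w)"
    using weight_push[of T l "reduce_word w"] by (simp add: reduce_word_foldr)
  then show ?case using Cons by (simp add: weight_Cons)
qed (simp add: reduce_word_def)

lemma weight_eq_0_iff: "weight T w = 0 \<longleftrightarrow> fst ` set w \<inter> T = {}"
  by (auto simp: weight_def filter_empty_conv)

text \<open>The prefixes of \<open>v\<close> form a chain, so the shorter of its overlaps with
  \<open>u\<close> and with \<open>w\<close> is common to \<open>u\<close> and \<open>w\<close>.
  This is the tree inequality for Gromov products.\<close>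

lemma weight_lcp_ultrametric:
  "min (weight T (lcp u v)) (weight T (lcp v w)) \<le> weight T (lcp u w)"
proof (induction u v arbitrary: w rule: lcp.induct)
  case (1 x u y v)
  then show ?case by (cases w) (auto simp: weight_Cons)
qed auto

section \<open>Normal forms and length functions over a free basis\<close>

locale free_basis = group +
  fixes B
  assumes basis_carrier: "B \<subseteq> carrier G"
    and generate_basis: "generate G B = carrier G"
    and basis_free: "(w :: ('a \<times> bool) list) \<noteq> [] \<Longrightarrow> reduced_word w \<Longrightarrow> fst ` set w \<subseteq> B \<Longrightarrow> eval_word G w \<noteq> \<one>"
begin

lemma over_carrier: "fst ` set w \<subseteq> B \<Longrightarrow> fst ` set w \<subseteq> carrier G"
  using basis_carrier by blast

text \<open>After the common prefix is stripped, the remainders form a reduced word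
  \<open>inv_word s @ t\<close> with value \<open>\<one>\<close>, which freeness forces to be
  empty.\<close>

lemma eval_word_inj:
  assumes "reduced_word u" "fst ` set u \<subseteq> B" "reduced_word v" "fst ` set v \<subseteq> B"
    and "eval_word G u = eval_word G v"
  shows "u = v"
proof -
  obtain p s t where st: "u = p @ s" "v = p @ t" "s = [] \<or> t = [] \<or> hd s \<noteq> hd t"
    using lcp_split by metis
  have B: "fst ` set p \<subseteq> B" "fst ` set s \<subseteq> B" "fst ` set t \<subseteq> B"
    using assms(2,4) by (auto simp: st)
  note C = B[THEN over_carrier]
  have red: "reduced_word (inv_word s @ t)"
    using st(3) assms(1,3) by (auto simp: st(1,2) reduced_word_append_iff last_inv_word)
  have "eval_word G p \<otimes> eval_word G s = eval_word G p \<otimes> eval_word G t"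
    using assms(5) C by (simp add: st(1,2) eval_word_append)
  then have "eval_word G s = eval_word G t"
    using C by (simp add: l_cancel)
  then have "eval_word G (inv_word s @ t) = \<one>"
    using C by (simp add: eval_word_append eval_word_inv_word)
  then have "inv_word s @ t = []"
    using basis_free[of "inv_word s @ t"] red B by (auto simp: image_Un)
  then show ?thesis
    using st by simp
qed

definition nf where
  "nf x = (THE w. reduced_word w \<and> fst ` set w \<subseteq> B \<and> eval_word G w = x)"

lemma nf_eqI: "reduced_word w \<Longrightarrow> fst ` set w \<subseteq> B \<Longrightarrow> eval_word G w = x \<Longrightarrow> nf x = w"
  unfolding nf_def by (rule the_equality) (auto intro: eval_word_inj)

lemma nf:
  assumes "x \<in> carrier G"
  shows "reduced_word (nf x)" "fst ` set (nf x) \<subseteq> B" "eval_word G (nf x) = x"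
proof -
  have "x \<in> eval_word G ` {w. fst ` set w \<subseteq> B}"
    using assms generate_basis by (simp add: generate_eq_eval_word[OF basis_carrier])
  then obtain w where w: "fst ` set w \<subseteq> B" "x = eval_word G w"
    by blast
  then have "reduced_word (reduce_word w)" "fst ` set (reduce_word w) \<subseteq> B"
    "eval_word G (reduce_word w) = x"
    using set_reduce_word[of w] by (auto simp: eval_word_reduce_word over_carrier)
  then show "reduced_word (nf x)" "fst ` set (nf x) \<subseteq> B" "eval_word G (nf x) = x"
    using nf_eqI[of "reduce_word w" x] by simp_all
qed

lemma nf_eval_word: "fst ` set w \<subseteq> B \<Longrightarrow> nf (eval_word G w) = reduce_word w"
  using set_reduce_word[of w] by (intro nf_eqI) (auto simp: eval_word_reduce_word over_carrier)

lemma nf_one [simp]: "nf \<one> = []"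
  by (rule nf_eqI) auto

lemma nf_inv: "x \<in> carrier G \<Longrightarrow> nf (inv x) = inv_word (nf x)"
  using nf by (intro nf_eqI) (auto simp: eval_word_inv_word over_carrier simp flip: image_set)

lemma nf_mult: "x \<in> carrier G \<Longrightarrow> y \<in> carrier G \<Longrightarrow> nf (x \<otimes> y) = reduce_word (nf x @ nf y)"
  using nf nf_eval_word[of "nf x @ nf y"]
  by (simp add: eval_word_append over_carrier image_Un)

lemma nf_eq_Nil_iff: "x \<in> carrier G \<Longrightarrow> nf x = [] \<longleftrightarrow> x = \<one>"
  using nf(3) by fastforce

text \<open>The distance by which \<open>x\<close> moves the base vertex of the tree dual to the
  free factor spanned by \<open>B - T\<close>; for \<open>T = UNIV\<close> it is the word
  length.\<close>

definition len where "len T x = weight T (nf x)"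

text \<open>The Gromov product belonging to \<open>len T\<close>, as \<open>len_inv_mult\<close>
  confirms.\<close>

definition gprod where "gprod T x y = weight T (lcp (nf x) (nf y))"

lemma len_one [simp]: "len T \<one> = 0"
  by (simp add: len_def)

lemma len_inv [simp]: "x \<in> carrier G \<Longrightarrow> len T (inv x) = len T x"
  by (simp add: len_def nf_inv)

lemma len_mult_le: "x \<in> carrier G \<Longrightarrow> y \<in> carrier G \<Longrightarrow> len T (x \<otimes> y) \<le> len T x + len T y"
  using weight_reduce_word[of T "nf x @ nf y"] by (simp add: len_def nf_mult)

lemma lcp_commute: "lcp u v = lcp v u"
  by (induction u v rule: lcp.induct) auto

lemma gprod_commute: "gprod T x y = gprod T y x"
  by (simp add: gprod_def lcp_commute)

lemma gprod_ultrametric: "min (gprod T x y) (gprod T y z) \<le> gprod T x z"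
  by (simp add: gprod_def weight_lcp_ultrametric)

text \<open>Exactly the common prefix of the two normal forms cancels.\<close>

lemma len_inv_mult:
  assumes "x \<in> carrier G" "y \<in> carrier G"
  shows "len T (inv x \<otimes> y) + 2 * gprod T x y = len T x + len T y"
proof -
  define p where "p = lcp (nf x) (nf y)"
  obtain s t where st: "nf x = p @ s" "nf y = p @ t" "s = [] \<or> t = [] \<or> hd s \<noteq> hd t"
    using lcp_split p_def by metis
  have B: "fst ` set p \<subseteq> B" "fst ` set s \<subseteq> B" "fst ` set t \<subseteq> B"
    using nf(2)[OF assms(1)] nf(2)[OF assms(2)] by (auto simp: st)
  note C = B[THEN over_carrier]
  have xy: "x = eval_word G p \<otimes> eval_word G s" "y = eval_word G p \<otimes> eval_word G t"
    using nf(3)[OF assms(1)] nf(3)[OF assms(2)] C by (simp_all add: st eval_word_append)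
  have red: "reduced_word (inv_word s @ t)"
    using st nf(1)[OF assms(1)] nf(1)[OF assms(2)]
    by (auto simp: reduced_word_append_iff last_inv_word)
  have "inv x \<otimes> y = eval_word G (inv_word s @ t)"
    using C by (simp add: xy eval_word_append eval_word_inv_word inv_mult_group m_assoc)
  then have "nf (inv x \<otimes> y) = inv_word s @ t"
    using red B by (intro nf_eqI) (auto simp: image_Un)
  then show ?thesis
    unfolding len_def gprod_def p_def[symmetric] by (simp add: st(1,2))
qed

text \<open>An element of the free factor spanned by the letters outside \<open>T\<close> fixes a single
  vertex of the tree dual to that factor, so it moves every other vertex by twice the distance.\<close>

lemma len_conj_null:
  assumes "x \<in> carrier G" "m \<in> carrier G" "len T m = 0" "m \<noteq> \<one>"
  shows "len T (inv x \<otimes> m \<otimes> x) = 2 * len T x"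
proof -
  \<comment> \<open>The prefix \<open>s\<close> is absorbed into \<open>m\<close>. No letter of the
    resulting \<open>m'\<close> lies in \<open>T\<close>, whereas \<open>r\<close>, if nonempty,
    starts with a letter in \<open>T\<close>; so nothing cancels in
    \<open>r^-1 m' r\<close>.\<close>
  define s r where "s = takeWhile (\<lambda>l. fst l \<notin> T) (nf x)" "r = dropWhile (\<lambda>l. fst l \<notin> T) (nf x)"
  have x: "nf x = s @ r" by (simp add: s_r_def)
  have s: "weight T s = 0"
    by (auto simp: weight_eq_0_iff s_r_def dest: set_takeWhileD)
  have B: "fst ` set s \<subseteq> B" "fst ` set r \<subseteq> B"
    using nf(2)[OF assms(1)] by (auto simp: x)
  note C = B[THEN over_carrier]
  have xe: "x = eval_word G s \<otimes> eval_word G r"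
    using nf(3)[OF assms(1)] C by (simp add: x eval_word_append)
  define m' where "m' = inv (eval_word G s) \<otimes> m \<otimes> eval_word G s"
  have m'C: "m' \<in> carrier G" using C assms by (simp add: m'_def)
  have "m' \<noteq> \<one>"
    using C assms conj_eq_one_iff[of "eval_word G s" m] by (simp add: m'_def)
  then have ne: "nf m' \<noteq> []" using m'C by (simp add: nf_eq_Nil_iff)
  have "len T (eval_word G s) = 0"
    using s B weight_reduce_word[of T s] by (simp add: len_def nf_eval_word)
  then have "len T m' \<le> 0"
    using C assms len_mult_le[of "inv (eval_word G s) \<otimes> m" "eval_word G s" T]
      len_mult_le[of "inv (eval_word G s)" m T]
    by (simp add: m'_def)
  then have w0: "weight T (nf m') = 0" by (simp add: len_def)
  have eq: "inv x \<otimes> m \<otimes> x = eval_word G (inv_word r @ nf m' @ r)"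
  proof -
    have "inv x \<otimes> m \<otimes> x = inv (eval_word G r) \<otimes> (m' \<otimes> eval_word G r)"
      using C assms by (simp add: xe m'_def inv_mult_group m_assoc)
    moreover have "fst ` set (nf m') \<subseteq> carrier G"
      using nf(2)[OF m'C] by (rule over_carrier)
    ultimately show ?thesis
      using C by (simp add: eval_word_append eval_word_inv_word image_Un nf(3)[OF m'C])
  qed
  have "reduced_word (inv_word r @ nf m' @ r)"
  proof (cases "r = []")
    case False
    then have "fst (hd r) \<in> T"
      using hd_dropWhile[of "\<lambda>l. fst l \<notin> T" "nf x"] by (simp add: s_r_def)
    moreover have "fst (hd (nf m')) \<notin> T" "fst (last (nf m')) \<notin> T"
      using w0 ne by (auto simp: weight_eq_0_iff disjoint_iff)
    ultimately have "hd (nf m') \<noteq> flip (flip (hd r))" "hd r \<noteq> flip (last (nf m'))"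
      by auto
    moreover have "reduced_word r" using nf(1)[OF assms(1)] x by (simp add: reduced_word_append_iff)
    ultimately show ?thesis
      using nf(1)[OF m'C] False ne
      by (simp add: reduced_word_append_iff last_inv_word)
  qed (simp add: nf(1)[OF m'C])
  then have "nf (inv x \<otimes> m \<otimes> x) = inv_word r @ nf m' @ r"
    using B nf(2)[OF m'C] eq by (intro nf_eqI) (auto simp: image_Un)
  then show ?thesis using s w0 by (simp add: len_def x)
qed

text \<open>For \<open>a = u d u^-1\<close> with \<open>d\<close> cyclically reduced,
  \<open>u d^n u^-1\<close> is reduced. So \<open>p\<close> counts letters of \<open>u\<close>, and
  the translation length \<open>q\<close> counts letters of \<open>d\<close>; \<open>n = 0\<close>
  is exceptional because \<open>u\<close> then cancels.\<close>

lemma len_pow: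
  assumes "a \<in> carrier G"
  shows "\<exists>p q. (\<forall>n>0. len T (a [^] (n::nat)) = 2 * p + n * q) \<and> (T = UNIV \<longrightarrow> a \<noteq> \<one> \<longrightarrow> q > 0)"
proof (cases "a = \<one>")
  case True
  then show ?thesis by (intro exI[of _ 0]) auto
next
  case False
  then obtain u d where ud: "nf a = u @ d @ inv_word u" "d \<noteq> []" "hd d \<noteq> flip (last d)"
    using reduced_word_conjugate_form nf(1) nf_eq_Nil_iff assms by metis
  have B: "fst ` set u \<subseteq> B" "fst ` set d \<subseteq> B"
    using nf(2)[OF assms(1)] by (auto simp: ud)
  note C = B[THEN over_carrier]
  have a: "a = eval_word G u \<otimes> eval_word G d \<otimes> inv (eval_word G u)"
    using nf(3)[OF assms] C
    by (simp add: ud eval_word_append eval_word_inv_word image_Un m_assoc)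
  have pow: "a [^] n = eval_word G (u @ concat (replicate n d) @ inv_word u)" for n :: nat
  proof (induction n)
    case 0
    then show ?case using C by (simp add: eval_word_append eval_word_inv_word)
  next
    case (Suc n)
    have D: "fst ` set (concat (replicate n d)) \<subseteq> carrier G"
      using C by (auto simp: image_subset_iff)
    have "a [^] Suc n = eval_word G u \<otimes> eval_word G d [^] Suc n \<otimes> inv (eval_word G u)"
      using Suc C D by (simp add: a eval_word_append eval_word_inv_word eval_word_replicate
          image_Un m_assoc)
    also have "\<dots> = eval_word G (u @ concat (replicate (Suc n) d) @ inv_word u)"
      using C D nat_pow_Suc2[of "eval_word G d" n]
      by (simp add: eval_word_append eval_word_inv_word eval_word_replicate image_Un m_assoc
           del: nat_pow_Suc)
    finally show ?case .
  qed
  have "len T (a [^] n) = 2 * weight T u + n * weight T d" if "n > 0" for n :: nat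
  proof -
    have "reduced_word (u @ concat (replicate n d) @ inv_word u)"
      using nf(1)[OF assms] ud that by (intro reduced_word_conjugate_power) auto
    then have "nf (a [^] n) = u @ concat (replicate n d) @ inv_word u"
      using B pow by (intro nf_eqI) (auto simp: image_Un image_subset_iff)
    then show ?thesis by (simp add: len_def)
  qed
  moreover have "weight UNIV d > 0" using ud by (simp add: weight_def)
  ultimately show ?thesis by blast
qed

end

section \<open>Translation lengths and the word \<open>b a b^-1 a^4\<close>\<close>

lemma (in group) conj_nat_pow:
  assumes "a \<in> carrier G" "b \<in> carrier G"
  shows "(b \<otimes> a \<otimes> inv b) [^] (n::nat) = b \<otimes> a [^] n \<otimes> inv b"
proof (induction n)
  case (Suc n)
  have "b \<otimes> a [^] n \<otimes> inv b \<otimes> (b \<otimes> a \<otimes> inv b) = b \<otimes> a [^] n \<otimes> a \<otimes> inv b"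
    using assms by (simp add: m_assoc)
  then show ?case using Suc assms by (simp add: m_assoc)
qed (use assms in simp)

lemma linear_growth_le:
  fixes p q p' q' :: nat
  assumes "\<And>n. n > 0 \<Longrightarrow> p' + n * q' \<le> p + n * q"
  shows "q' \<le> q"
proof (rule ccontr)
  assume "\<not> q' \<le> q"
  then have "Suc p * Suc q \<le> Suc p * q'" by (intro mult_left_mono) auto
  then show False using assms[of "Suc p"] by simp
qed

context free_basis begin

text \<open>Comparing the lengths of the powers \<open>n\<close>, \<open>m\<close> and
  \<open>n + m\<close> shows that exactly the conjugating part, of length \<open>p\<close>,
  cancels.\<close>

lemma gprod_pow:
  assumes "a \<in> carrier G" "\<And>n. n > 0 \<Longrightarrow> len T (a [^] (n::nat)) = 2 * p + n * q" "n > 0" "m > 0"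
  shows "gprod T (inv (a [^] (n::nat))) (a [^] (m::nat)) = p"
  using len_inv_mult[of "inv (a [^] n)" "a [^] m" T] assms
  by (simp add: nat_pow_mult algebra_simps)

lemma len_null_mult:
  assumes "x \<in> carrier G" "m \<in> carrier G" "len T m = 0"
  shows "len T (m \<otimes> x) = len T x"
proof -
  have "len T (inv m \<otimes> (m \<otimes> x)) \<le> len T (inv m) + len T (m \<otimes> x)"
    using assms by (intro len_mult_le) auto
  then show ?thesis
    using assms len_mult_le[of m x T] by simp
qed

lemma len_mult_null:
  assumes "x \<in> carrier G" "m \<in> carrier G" "len T m = 0"
  shows "len T (x \<otimes> m) = len T x"
  using len_null_mult[of "inv x" "inv m" T] assms
  by (metis inv_closed inv_mult_group len_inv m_closed)

lemma gprod_mult_null: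
  assumes "x \<in> carrier G" "m \<in> carrier G" "len T m = 0"
  shows "gprod T x (x \<otimes> m) = len T x"
  using len_inv_mult[of x "x \<otimes> m" T] len_mult_null[OF assms] assms by simp

text \<open>Edge stabilisers are trivial: a nontrivial \<open>m\<close> fixing the base vertex fixes
  no edge there, so the paths towards \<open>x\<close> and \<open>m x\<close> part at once.\<close>

lemma gprod_null_mult:
  assumes "x \<in> carrier G" "m \<in> carrier G" "len T m = 0" "m \<noteq> \<one>"
  shows "gprod T x (m \<otimes> x) = 0"
  using len_inv_mult[of x "m \<otimes> x" T] len_null_mult[of x m T] len_conj_null[of x m T] assms
  by (simp add: m_assoc)

text \<open>Conjugation by \<open>b\<close> adds at most \<open>2 * len T b\<close> to every power,
  which cannot raise the linear growth rate.\<close>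

lemma len_conj_pow_le:
  assumes "a \<in> carrier G" "b \<in> carrier G"
    and "\<And>n. n > 0 \<Longrightarrow> len T (a [^] (n::nat)) = 2 * p + n * q"
    and "\<And>n. n > 0 \<Longrightarrow> len T ((b \<otimes> a \<otimes> inv b) [^] (n::nat)) = 2 * p' + n * q'"
  shows "q' \<le> q"
proof (rule linear_growth_le[of "2 * p'" _ "2 * len T b + 2 * p"])
  fix n :: nat assume "n > 0"
  have "len T (b \<otimes> a [^] n \<otimes> inv b) \<le> len T (b \<otimes> a [^] n) + len T b"
    using len_mult_le[of "b \<otimes> a [^] n" "inv b" T] assms by simp
  also have "\<dots> \<le> len T b + len T (a [^] n) + len T b"
    using len_mult_le[of b "a [^] n" T] assms by simp
  finally show "2 * p' + n * q' \<le> 2 * len T b + 2 * p + n * q"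
    using assms \<open>n > 0\<close> by (simp add: conj_nat_pow)
qed

lemma pow_neq_one:
  assumes "a \<in> carrier G" "a \<noteq> \<one>" "n > 0"
  shows "a [^] (n::nat) \<noteq> \<one>"
  using len_pow[OF assms(1), of UNIV] assms by (metis add_gr_0 len_one less_numeral_extra(3) nat_0_less_mult_iff)

text \<open>Geometrically: if \<open>a\<close> translates the tree dual to the free factor \<open>len T x = 0\<close>
  by \<open>q\<close>, then so does its conjugate \<open>b a b\<^sup>-\<^sup>1 = l a\<^sup>-\<^sup>4\<close>; but \<open>l\<close> fixes a vertex, and
  since edge stabilisers are trivial, at most \<open>2 q\<close> of the \<open>4 q\<close> can be lost by cancellation.\<close>

lemma klein_word_null:
  assumes a: "a \<in> carrier G" "a \<noteq> \<one>" and b: "b \<in> carrier G"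
    and null: "len T (b \<otimes> a \<otimes> inv b \<otimes> a [^] (4::nat)) = 0"
  shows "len T a = 0 \<and> len T b = 0"
proof -
  define l where "l = b \<otimes> a \<otimes> inv b \<otimes> a [^] (4::nat)"
  define g where "g = b \<otimes> a \<otimes> inv b"
  have C [simp]: "l \<in> carrier G" "g \<in> carrier G" "a [^] n \<in> carrier G" "a \<in> carrier G" "b \<in> carrier G"
    for n :: nat using a b by (auto simp: l_def g_def)
  have l0: "len T l = 0" using null by (simp add: l_def)
  have g: "g = l \<otimes> inv (a [^] (4::nat))"
    using a b by (simp add: l_def g_def m_assoc)
  \<comment> \<open>Otherwise \<open>b a b^-1 = a^-4\<close>, and the growth rate
    \<open>q > 0\<close> of the word length of \<open>a^n\<close> would satisfy
    \<open>4 * q \<le> q\<close>.\<close>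
  have l1: "l \<noteq> \<one>"
  proof
    assume "l = \<one>"
    then have "g = inv (a [^] (4::nat))" by (simp add: g)
    then have "g [^] n = inv (a [^] (4 * n))" for n :: nat
      by (simp add: nat_pow_inv nat_pow_pow)
    moreover obtain p q where pq: "\<And>n. n > 0 \<Longrightarrow> len UNIV (a [^] (n::nat)) = 2 * p + n * q" "q > 0"
      using len_pow[OF a(1), of UNIV] a(2) by auto
    ultimately have "len UNIV ((b \<otimes> a \<otimes> inv b) [^] n) = 2 * p + n * (4 * q)" if "n > 0" for n :: nat
      using that by (simp flip: g_def)
    from len_conj_pow_le[OF a(1) b pq(1) this] pq(2) show False by simp
  qed
  obtain p q where pq: "\<And>n. n > 0 \<Longrightarrow> len T (a [^] (n::nat)) = 2 * p + n * q"
    using len_pow[OF a(1), of T] by auto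
  obtain p' q' where pq': "\<And>n. n > 0 \<Longrightarrow> len T (g [^] (n::nat)) = 2 * p' + n * q'"
    using len_pow[of g T] by auto
  have "q' \<le> q"
    using len_conj_pow_le[OF a(1) b pq pq'[unfolded g_def]] .
  have "len T g = 2 * p + 4 * q"
    unfolding g using pq[of 4] l0 by (simp add: len_null_mult)
  then have p'q': "2 * p' + q' = 2 * p + 4 * q" using pq'[of 1] by simp
  have p': "gprod T (inv g) g = p'" using gprod_pow[OF _ pq', of 1 1] by simp
  have ig: "inv g = a [^] (4::nat) \<otimes> inv l" by (simp add: g inv_mult_group)
  have 1: "gprod T (inv g) (a [^] (4::nat)) = 2 * p + 4 * q"
    using gprod_mult_null[of "a [^] (4::nat)" "inv l" T] l0 pq[of 4] by (simp add: gprod_commute ig)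
  have "q = 0 \<and> p = 0"
  proof (cases "p > 0")
    case True
    \<comment> \<open>\<open>inv g\<close> begins like \<open>a^4\<close>, hence through the
      conjugating part of \<open>a\<close> also like \<open>a^-4\<close>; but
      \<open>g = l a^-4\<close> shares nothing with \<open>a^-4\<close>. So \<open>g\<close> and
      \<open>inv g\<close> share nothing, \<open>p' = 0\<close>, and \<open>q' \<le> q\<close>
      contradicts the length of \<open>g\<close>.\<close>
    let ?y = "inv (a [^] (4::nat))"
    have "min (gprod T g (inv g)) (gprod T (inv g) ?y) \<le> gprod T g ?y"
      by (rule gprod_ultrametric)
    moreover have "gprod T g ?y = 0"
      using gprod_null_mult[of ?y l T] l0 l1 by (simp add: g gprod_commute)
    moreover have "gprod T (inv g) ?y > 0"
    proof -
      have "min (gprod T (inv g) (a [^] (4::nat))) (gprod T (a [^] (4::nat)) ?y) \<le> gprod T (inv g) ?y"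
        by (rule gprod_ultrametric)
      moreover have "gprod T (a [^] (4::nat)) ?y = p"
        using gprod_pow[OF a(1) pq, of 4 4] by (simp add: gprod_commute)
      ultimately show ?thesis using 1 True by simp
    qed
    ultimately have "p' = 0" using p' by (simp add: gprod_commute)
    then show ?thesis using p'q' \<open>q' \<le> q\<close> True by simp
  next
    case False
    then have p0: "p = 0" by simp
    have "q = 0"
    proof (rule ccontr)
      assume "q \<noteq> 0"
      \<comment> \<open>Here \<open>2 * p' = 4 * q - q' \<ge> 3 * q\<close>. The exponent 4 is the
        least for which this count gives an overlap longer than one period of
        \<open>a\<close>.\<close>
      have "p' > q" using p'q' \<open>q' \<le> q\<close> \<open>q \<noteq> 0\<close> p0 by linarith
      \<comment> \<open>\<open>c^4 = g l^-1\<close> and \<open>a^4 = g^-1 l\<close> differ from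
        \<open>g\<close> and \<open>inv g\<close> by right factors fixing the base vertex, so they
        inherit the overlap of \<open>g\<close> and \<open>inv g\<close>.\<close>
      define c where "c = l \<otimes> inv a \<otimes> inv l"
      have c [simp]: "c \<in> carrier G" "c [^] n \<in> carrier G" for n :: nat by (auto simp: c_def)
      have cn: "c [^] n = l \<otimes> inv (a [^] n) \<otimes> inv l" for n :: nat
        unfolding c_def by (simp add: conj_nat_pow nat_pow_inv)
      have lcn: "len T (c [^] n) = n * q" if "n > 0" for n :: nat
        using that l0 pq p0 by (simp add: cn len_mult_null len_null_mult)
      have lan: "len T (a [^] n) = n * q" if "n > 0" for n :: nat
        using that pq p0 by simp
      have pow_shift: "gprod T (x [^] n) (x [^] m) = n * q"
        if "n > 0" "n < m" "x \<in> carrier G" "\<And>n. n > 0 \<Longrightarrow> len T (x [^] n) = n * q" for n m :: nat and x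
      proof -
        have "x [^] m = x [^] n \<otimes> x [^] (m - n)" using that by (simp add: nat_pow_mult)
        then have "inv (x [^] n) \<otimes> x [^] m = x [^] (m - n)" using that by simp
        moreover have "(m - n) * q + 2 * (n * q) = n * q + m * q"
          using that by (simp add: diff_mult_distrib)
        ultimately show ?thesis using len_inv_mult[of "x [^] n" "x [^] m" T] that by simp
      qed
      have "gprod T g (c [^] (4::nat)) = 4 * q"
      proof -
        have "c [^] (4::nat) = g \<otimes> inv l" by (simp add: cn g)
        then show ?thesis
          using gprod_mult_null[of g "inv l" T] l0 \<open>len T g = 2 * p + 4 * q\<close> p0 by simp
      qed
      moreover have "gprod T (inv g) (a [^] (4::nat)) = 4 * q" using 1 p0 by simp
      moreover note gprod_ultrametric[of T "a [^] (4::nat)" "inv g" "g"]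
        gprod_ultrametric[of T "a [^] (4::nat)" "g" "c [^] (4::nat)"]
      ultimately have ac4: "gprod T (a [^] (4::nat)) (c [^] (4::nat)) > q"
        using p' \<open>p' > q\<close> \<open>q \<noteq> 0\<close> by (simp add: gprod_commute)
      \<comment> \<open>The overlap covers a full period, so \<open>a\<close> and \<open>c\<close>
        agree up to an element \<open>m\<close> of the free factor.\<close>
      define m where "m = inv a \<otimes> c"
      have m [simp]: "m \<in> carrier G" by (simp add: m_def)
      have "len T m = 0"
      proof -
        have "gprod T a (a [^] (4::nat)) = q" using pow_shift[of 1 4 a] lan by simp
        moreover have "gprod T c (c [^] (4::nat)) = q" using pow_shift[of 1 4 c] lcn by simp
        moreover note gprod_ultrametric[of T a "a [^] (4::nat)" "c [^] (4::nat)"]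
          gprod_ultrametric[of T a "c [^] (4::nat)" c]
        ultimately have "gprod T a c \<ge> q" using ac4 by (simp add: gprod_commute)
        then show ?thesis
          using len_inv_mult[of a c T] lan[of 1] lcn[of 1] by (simp add: m_def)
      qed
      have "m = \<one>"
      proof (rule ccontr)
        assume "m \<noteq> \<one>"
        have a4: "x [^] (4::nat) = x \<otimes> x [^] (3::nat)" if "x \<in> carrier G" for x
          using nat_pow_Suc2[OF that, of 3] by (simp del: nat_pow_Suc)
        \<comment> \<open>The overlap exceeds one period, so some of it survives the removal of
          \<open>a\<close> from \<open>a^4\<close> and \<open>c^4\<close>. Then \<open>c^3\<close>
          and \<open>m c^3\<close> would start alike, against
          \<open>gprod_null_mult\<close>.\<close>
        have "gprod T (a [^] (3::nat)) (m \<otimes> c [^] (3::nat)) > 0"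
        proof -
          have "inv (a [^] (3::nat)) \<otimes> (m \<otimes> c [^] (3::nat)) = inv (a [^] (4::nat)) \<otimes> c [^] (4::nat)"
            by (simp add: a4 m_def inv_mult_group m_assoc)
          then show ?thesis
            using len_inv_mult[of "a [^] (3::nat)" "m \<otimes> c [^] (3::nat)" T]
              len_inv_mult[of "a [^] (4::nat)" "c [^] (4::nat)" T] ac4
              lan[of 3] lan[of 4] lcn[of 3] lcn[of 4] \<open>len T m = 0\<close>
            by (simp add: len_null_mult)
        qed
        moreover have "gprod T (a [^] (3::nat)) (c [^] (3::nat)) > 0"
          using gprod_ultrametric[of T "a [^] (3::nat)" "a [^] (4::nat)" "c [^] (4::nat)"]
            gprod_ultrametric[of T "a [^] (3::nat)" "c [^] (4::nat)" "c [^] (3::nat)"]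
            pow_shift[of 3 4 a] pow_shift[of 3 4 c] lan lcn ac4 \<open>q \<noteq> 0\<close>
          by (simp add: gprod_commute)
        moreover note gprod_ultrametric[of T "m \<otimes> c [^] (3::nat)" "a [^] (3::nat)" "c [^] (3::nat)"]
        ultimately show False
          using gprod_null_mult[of "c [^] (3::nat)" m T] \<open>m \<noteq> \<one>\<close> \<open>len T m = 0\<close>
          by (simp add: gprod_commute)
      qed
      then have "c = a"
        using inv_mult_cancel(2)[of a c] by (simp add: m_def)
      \<comment> \<open>Conjugation by \<open>l\<close> now inverts \<open>a\<close>, so
        \<open>l^2\<close> commutes with \<open>a\<close>. But \<open>l^2\<close> is nontrivial and
        fixes the base vertex, which \<open>a\<close> moves by \<open>q\<close>, against
        \<open>len_conj_null\<close>.\<close>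
      then have la: "l \<otimes> inv a = a \<otimes> l"
        unfolding c_def by (metis C(1) C(4) inv_closed inv_solve_right m_closed)
      then have al: "inv a \<otimes> l = l \<otimes> a"
        by (metis C(1) C(4) inv_closed inv_mult_cancel(1) inv_mult_cancel m_assoc m_closed l_inv r_one)
      have "inv a \<otimes> (l \<otimes> l) \<otimes> a = l \<otimes> l"
      proof -
        have "inv a \<otimes> (l \<otimes> l) \<otimes> a = (inv a \<otimes> l) \<otimes> (l \<otimes> a)" by (simp add: m_assoc)
        also have "\<dots> = l \<otimes> (a \<otimes> l) \<otimes> a" unfolding al by (simp add: m_assoc)
        also have "\<dots> = l \<otimes> l" unfolding la[symmetric] by (simp add: m_assoc)
        finally show ?thesis .
      qed
      moreover have "len T (l \<otimes> l) = 0" using l0 by (simp add: len_null_mult)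
      moreover have "l \<otimes> l \<noteq> \<one>" using pow_neq_one[of l 2] l1 by (simp add: numeral_2_eq_2)
      ultimately show False
        using len_conj_null[of a "l \<otimes> l" T] lan[of 1] \<open>q \<noteq> 0\<close> by simp
    qed
    then show ?thesis using p0 by simp
  qed
  then have "len T a = 0" "len T g = 0" using pq[of 1] \<open>len T g = 2 * p + 4 * q\<close> by auto
  moreover from this have "len T b = 0"
    using len_conj_null[of "inv b" a T] a by (simp add: g_def)
  ultimately show ?thesis by blast
qed

end

section \<open>Two incompatible systems of equations\<close>

text \<open>The two systems of equations are \<open>x\<^sub>n = slender_step G g\<^sub>n k\<^sub>n x\<^sub>n\<^sub>+\<^sub>1\<close> with \<open>k\<^sub>n = 0\<close> for all \<open>n\<close>
  (first system) and with \<open>k\<^sub>n > 0\<close> for all \<open>n\<close> (second system).\<close>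

definition slender_step :: "('a, 'm) monoid_scheme \<Rightarrow> 'a \<Rightarrow> nat \<Rightarrow> 'a \<Rightarrow> 'a" where
  "slender_step G g k x =
     (if k = 0 then x \<otimes>\<^bsub>G\<^esub> g \<otimes>\<^bsub>G\<^esub> inv\<^bsub>G\<^esub> x \<otimes>\<^bsub>G\<^esub> g [^]\<^bsub>G\<^esub> (4::nat) else g \<otimes>\<^bsub>G\<^esub> x [^]\<^bsub>G\<^esub> k)"

context group begin

lemma slender_step_closed [simp]:
  "g \<in> carrier G \<Longrightarrow> x \<in> carrier G \<Longrightarrow> slender_step G g k x \<in> carrier G"
  by (simp add: slender_step_def)

lemma slender_step_subgroup:
  assumes "subgroup S G" "g \<in> S" "x \<in> S"
  shows "slender_step (G\<lparr>carrier := S\<rparr>) g k x = slender_step G g k x"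
  using assms by (simp add: slender_step_def m_inv_consistent flip: nat_pow_consistent)

lemma eval_word_subgroup:
  "subgroup S G \<Longrightarrow> fst ` set w \<subseteq> S \<Longrightarrow> eval_word (G\<lparr>carrier := S\<rparr>) w = eval_word G w"
  by (induction w) (auto simp: eval_word_def m_inv_consistent)

end

lemma (in group_hom) hom_slender_step:
  "g \<in> carrier G \<Longrightarrow> x \<in> carrier G \<Longrightarrow>
     h (slender_step G g k x) = slender_step H (h g) k (h x)"
  by (simp add: slender_step_def hom_nat_pow)

lemma aleph1_free_basis:
  assumes "aleph1_free H" "A \<subseteq> carrier H" "countable A"
  shows "\<exists>B. free_basis (H\<lparr>carrier := generate H A\<rparr>) B"
proof -
  interpret group H using assms by (simp add: aleph1_free_def)
  have "free_group (H\<lparr>carrier := generate H A\<rparr>)"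
    using assms by (simp add: aleph1_free_def generate_is_subgroup countable_generate)
  then show ?thesis
    unfolding free_group_def free_basis_def free_basis_axioms_def by blast
qed

lemma (in free_basis) len_eval_word_le:
  assumes "finite A" "A \<subseteq> carrier G" "fst ` set w \<subseteq> A"
  shows "len T (eval_word G w) \<le> (\<Sum>b\<in>A. len T b) * length w"
  using assms(3)
proof (induction w)
  case (Cons l w)
  let ?b = "if snd l then inv (fst l) else fst l"
  have "len T (eval_word G (l # w)) \<le> len T ?b + len T (eval_word G w)"
    using Cons.prems assms(2) unfolding eval_word_Cons by (intro len_mult_le) auto
  moreover have "len T ?b \<le> (\<Sum>b\<in>A. len T b)"
    using Cons.prems assms member_le_sum[of "fst l" A "len T"] by auto
  ultimately show ?case using Cons by simp
qed simp

text \<open>The solution \<open>x\<close> confines all \<open>h n\<close> to the span of finitely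
  many basis elements \<open>B0\<close> of a subgroup chosen without reference to \<open>w\<close>,
  so \<open>N\<close> can be fixed first. Passing to a subgroup containing \<open>w\<close> costs
  only a constant factor \<open>C\<close>, which the factor \<open>n\<close> in the exponent
  eventually reaches.\<close>

lemma aleph1_free_no_simultaneous_solutions:
  fixes H :: "('a, 'm) monoid_scheme"
  assumes "aleph1_free H"
    and h: "\<And>n. h n \<in> carrier H" "\<And>n. h n \<noteq> \<one>\<^bsub>H\<^esub>"
    and x: "\<And>n. x n \<in> carrier H" "\<And>n. x n = slender_step H (h n) 0 (x (Suc n))"
  shows "\<exists>N :: nat \<Rightarrow> nat. \<forall>i w. (\<forall>n. w n \<in> carrier H) \<longrightarrow>
     (\<exists>n. w n \<noteq> slender_step H (h (i n)) (n * N (i n) + 2) (w (Suc n)))"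
proof -
  interpret H: group H using assms(1) by (simp add: aleph1_free_def)
  define S1 where "S1 = generate H (range h \<union> range x)"
  have S1: "subgroup S1 H" unfolding S1_def using h x(1) by (intro H.generate_is_subgroup) auto
  have hS1: "h n \<in> S1" and xS1: "x n \<in> S1" for n by (auto simp: S1_def intro: generate.incl)
  obtain B1 where "free_basis (H\<lparr>carrier := S1\<rparr>) B1"
    using aleph1_free_basis[OF assms(1), of "range h \<union> range x"] h x(1) unfolding S1_def by auto
  then interpret K1: free_basis "H\<lparr>carrier := S1\<rparr>" B1 .
  define B0 where "B0 = fst ` set (K1.nf (x 0))"
  have B0: "finite B0" "B0 \<subseteq> S1"
    using K1.nf(2)[of "x 0"] K1.basis_carrier xS1 by (auto simp: B0_def)
  \<comment> \<open>\<open>klein_word_null\<close> with \<open>T\<close> the complement of the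
    letters of \<open>x 0\<close>: lying in the span of \<open>B0\<close> passes from
    \<open>x n\<close> to \<open>h n\<close> and \<open>x (Suc n)\<close>.\<close>
  have xh: "K1.len (- B0) (h n) = 0 \<and> K1.len (- B0) (x (Suc n)) = 0"
    if "K1.len (- B0) (x n) = 0" for n
    using K1.klein_word_null[of "h n" "x (Suc n)" "- B0"] that hS1 xS1 h
      H.slender_step_subgroup[OF S1 hS1 xS1, of n 0 "Suc n"] x(2)[of n]
    by (simp add: slender_step_def)
  have "K1.len (- B0) (x n) = 0" for n
  proof (induction n)
    case 0
    then show ?case by (simp add: K1.len_def weight_eq_0_iff B0_def)
  qed (use xh in blast)
  then have hB0: "fst ` set (K1.nf (h n)) \<subseteq> B0" for n
    using xh[of n] by (auto simp: K1.len_def weight_eq_0_iff)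
  define N where "N n = length (K1.nf (h n))" for n
  show ?thesis
  proof (intro exI[of _ N] allI impI)
    fix i :: "nat \<Rightarrow> nat" and w :: "nat \<Rightarrow> 'a"
    assume w: "\<forall>n. w n \<in> carrier H"
    show "\<exists>n. w n \<noteq> slender_step H (h (i n)) (n * N (i n) + 2) (w (Suc n))"
    proof (rule ccontr)
      assume "\<nexists>n. w n \<noteq> slender_step H (h (i n)) (n * N (i n) + 2) (w (Suc n))"
      then have weq: "w n = slender_step H (h (i n)) (n * N (i n) + 2) (w (Suc n))" for n by blast
      define A where "A = range h \<union> range x \<union> range w"
      have A: "A \<subseteq> carrier H" "countable A" using h x(1) w by (auto simp: A_def)
      define S2 where "S2 = generate H A"
      have S2: "subgroup S2 H" unfolding S2_def using A by (intro H.generate_is_subgroup)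
      have S12: "S1 \<subseteq> S2" unfolding S1_def S2_def A_def by (intro H.mono_generate) auto
      have hS2: "h n \<in> S2" and wS2: "w n \<in> S2" for n
        by (auto simp: S2_def A_def intro: generate.incl)
      obtain B2 where "free_basis (H\<lparr>carrier := S2\<rparr>) B2"
        using aleph1_free_basis[OF assms(1) A] unfolding S2_def by auto
      then interpret K2: free_basis "H\<lparr>carrier := S2\<rparr>" B2 .
      let ?len = "K2.len UNIV"
      \<comment> \<open>\<open>C\<close> depends on \<open>w\<close> through the basis
        \<open>B2\<close>, but not on \<open>n\<close>, since one finite set \<open>B0\<close>
        serves all \<open>h n\<close>.\<close>
      define C where "C = (\<Sum>b\<in>B0. ?len b)"
      have lenh: "?len (h n) \<le> C * N n" for n
      proof -
        have "h n = eval_word H (K1.nf (h n))"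
          using K1.nf(3)[of "h n"] H.eval_word_subgroup[OF S1, of "K1.nf (h n)"] hB0[of n] B0 hS1
          by auto
        also have "\<dots> = eval_word (H\<lparr>carrier := S2\<rparr>) (K1.nf (h n))"
          using H.eval_word_subgroup[OF S2, of "K1.nf (h n)"] hB0[of n] B0 S12 by auto
        finally show ?thesis
          using K2.len_eval_word_le[OF B0(1) _ hB0[of n], of UNIV] B0(2) S12
          by (auto simp: C_def N_def)
      qed
      have wstep: "w n = h (i n) \<otimes>\<^bsub>H\<^esub> w (Suc n) [^]\<^bsub>H\<lparr>carrier := S2\<rparr>\<^esub> (n * N (i n) + 2)" for n
        using weq[of n] H.nat_pow_consistent[of "w (Suc n)" "n * N (i n) + 2" S2]
        unfolding slender_step_def by simp
      \<comment> \<open>The summand \<open>n * N (i n)\<close> of the exponent pays for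
        \<open>h (i n)\<close>. The summand \<open>2\<close> leaves
        \<open>2 * p + 2 * q \<le> ?len (w n)\<close>, which exceeds the length
        \<open>2 * p + q\<close> of \<open>w (Suc n)\<close>.\<close>
      have less: "?len (w (Suc n)) < ?len (w n)"
        if nC: "n \<ge> C" and ne: "w (Suc n) \<noteq> \<one>\<^bsub>H\<^esub>" for n
      proof -
        let ?k = "n * N (i n) + 2"
        let ?p = "w (Suc n) [^]\<^bsub>H\<lparr>carrier := S2\<rparr>\<^esub> ?k"
        obtain p q where pq: "\<And>m. m > 0 \<Longrightarrow>
            ?len (w (Suc n) [^]\<^bsub>H\<lparr>carrier := S2\<rparr>\<^esub> (m::nat)) = 2 * p + m * q" "q > 0"
          using K2.len_pow[of "w (Suc n)" UNIV] wS2 ne by auto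
        have pS2: "?p \<in> S2" using K2.nat_pow_closed[of "w (Suc n)" ?k] wS2 by simp
        have "?p = inv\<^bsub>H\<lparr>carrier := S2\<rparr>\<^esub> (h (i n)) \<otimes>\<^bsub>H\<^esub> w n"
          using wstep[of n] K2.inv_mult_cancel(1)[of "h (i n)" ?p] pS2 hS2 by simp
        then have "?len ?p \<le> ?len (h (i n)) + ?len (w n)"
          using K2.len_mult_le[of "inv\<^bsub>H\<lparr>carrier := S2\<rparr>\<^esub> (h (i n))" "w n" UNIV] hS2 wS2
            K2.inv_closed[of "h (i n)"]
          by simp
        then have "2 * p + ?k * q \<le> C * N (i n) + ?len (w n)"
          using lenh[of "i n"] pq(1)[of ?k] by linarith
        moreover have "C * N (i n) \<le> n * N (i n)" using nC by simp
        moreover have "n * N (i n) \<le> n * N (i n) * q" using pq(2) by simp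
        moreover have "?k * q = n * N (i n) * q + q + q" by (simp add: algebra_simps)
        moreover have "?len (w (Suc n)) = 2 * p + q"
          using pq(1)[of 1] wS2 K2.l_one[of "w (Suc n)"] by simp
        ultimately show ?thesis using pq(2) by linarith
      qed
      \<comment> \<open>If \<open>w n\<close> is trivial, then a trivial \<open>w (Suc n)\<close>
        would make \<open>h (i n)\<close> trivial, and a nontrivial one would have length below
        \<open>0\<close>.\<close>
      have ne: "w n \<noteq> \<one>\<^bsub>H\<^esub>" if "n \<ge> C" for n
      proof
        assume 1: "w n = \<one>\<^bsub>H\<^esub>"
        show False
        proof (cases "w (Suc n) = \<one>\<^bsub>H\<^esub>")
          case True
          then have "w n = h (i n)" using weq[of n] h by (simp add: slender_step_def)
          then show False using h 1 by metis
        next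
          case False
          then show False using less[OF that] 1 K2.len_one by simp
        qed
      qed
      have "?len (w (C + n)) + n \<le> ?len (w C)" for n
      proof (induction n)
        case (Suc n)
        then show ?case using less[of "C + n"] ne[of "Suc (C + n)"] by simp
      qed simp
      from this[of "Suc (?len (w C))"] show False by simp
    qed
  qed
qed

text \<open>The filter plays the role of the neighbourhoods of \<open>\<one>\<close>, and \<open>V\<close> is a strategy: as long as each
  \<open>g\<^sub>m\<close> is chosen in the neighbourhood \<open>V\<close> dictated by the previous moves, the infinite system of
  equations has a solution. To reconcile the first system, whose letters are all \<open>g\<^sub>m\<close>, with the
  second one, whose exponents depend on the solution of the first, each \<open>g\<^sub>m\<close> obeys the strategy for
  all finitely many sequences of earlier moves with parameters at most \<open>m\<close>; the second system
  then uses a sufficiently sparse subsequence.\<close>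

lemma aleph1_free_hom_eventually_trivial:
  fixes G :: "('b, 'n) monoid_scheme" and H :: "('a, 'm) monoid_scheme"
    and V :: "('b \<times> nat) list \<Rightarrow> 'b set"
  assumes "group G" "aleph1_free H" "\<phi> \<in> hom G H"
    and V: "\<And>ps. set ps \<subseteq> carrier G \<times> UNIV \<Longrightarrow> eventually (\<lambda>g. g \<in> V ps) F"
    and carr: "eventually (\<lambda>g. g \<in> carrier G) F"
    and solve: "\<And>g k. (\<And>m. g m \<in> carrier G) \<Longrightarrow>
      (\<And>m. g m \<in> V (map (\<lambda>i. (g i, k i)) [0..<m])) \<Longrightarrow>
      \<exists>x. \<forall>n. x n \<in> carrier G \<and> x n = slender_step G (g n) (k n) (x (Suc n))"
  shows "eventually (\<lambda>g. \<phi> g = \<one>\<^bsub>H\<^esub>) F"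
proof (rule ccontr)
  assume nontriv: "\<not> eventually (\<lambda>g. \<phi> g = \<one>\<^bsub>H\<^esub>) F"
  interpret group_hom G H \<phi>
    using assms(1-3) by (simp add: group_hom_def group_hom_axioms_def aleph1_free_def)
  \<comment> \<open>Bounding lengths and parameters by \<open>length gs\<close> makes this set
    finite, so a single new letter can obey the strategy in all these positions at once.\<close>
  define plays where
    "plays gs = {ps. set ps \<subseteq> set gs \<times> {..length gs} \<and> length ps \<le> length gs}" for gs :: "'b list"
  define good where
    "good gs g \<longleftrightarrow> g \<in> carrier G \<and> \<phi> g \<noteq> \<one>\<^bsub>H\<^esub> \<and> (\<forall>ps\<in>plays gs. g \<in> V ps)" for gs g
  have good: "\<exists>g. good gs g" if "set gs \<subseteq> carrier G" for gs
  proof (rule ccontr)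
    assume "\<nexists>g. good gs g"
    moreover have "finite (plays gs)"
      unfolding plays_def by (intro finite_lists_length_le) auto
    then have "eventually (\<lambda>g. \<forall>ps\<in>plays gs. g \<in> V ps) F"
      using that V unfolding plays_def by (intro eventually_ball_finite) fastforce+
    then have "eventually (\<lambda>g. g \<in> carrier G \<and> (\<forall>ps\<in>plays gs. g \<in> V ps)) F"
      using carr by (rule eventually_conj[rotated])
    then have "eventually (\<lambda>g. \<phi> g = \<one>\<^bsub>H\<^esub>) F"
      by (rule eventually_mono) (use calculation in \<open>auto simp: good_def\<close>)
    then show False using nontriv by blast
  qed
  define L where "L = rec_nat [] (\<lambda>_ gs. gs @ [SOME g. good gs g])"
  define g where "g n = (SOME g. good (L n) g)" for n
  have L: "L n = map g [0..<n]" for n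
    by (induction n) (simp_all add: L_def g_def)
  have gC: "set (L n) \<subseteq> carrier G \<and> good (L n) (g n)" for n
  proof (induction n)
    case 0
    then show ?case using someI_ex[OF good[of "L 0"]] by (simp add: L g_def)
  next
    case (Suc n)
    then have "set (L (Suc n)) \<subseteq> carrier G" by (auto simp: L good_def)
    then show ?case using someI_ex[OF good[of "L (Suc n)"]] by (simp add: g_def)
  qed
  then have g: "g n \<in> carrier G" "\<phi> (g n) \<noteq> \<one>\<^bsub>H\<^esub>" for n
    by (auto simp: good_def)
  have gV: "g n \<in> V ps"
    if "set ps \<subseteq> g ` {..<n} \<times> {..n}" "length ps \<le> n" for n ps
    using gC[of n] that by (auto simp: good_def plays_def L lessThan_atLeast0)
  have "\<exists>x. \<forall>n. x n \<in> carrier G \<and> x n = slender_step G (g n) 0 (x (Suc n))"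
    using g by (intro solve gV) auto
  then obtain x where x: "\<And>n. x n \<in> carrier G" "\<And>n. x n = slender_step G (g n) 0 (x (Suc n))"
    by blast
  have xH: "\<phi> (x n) = slender_step H (\<phi> (g n)) 0 (\<phi> (x (Suc n)))" for n
    using hom_slender_step[OF g(1)[of n] x(1)[of "Suc n"], of 0] x(2)[of n] by simp
  from aleph1_free_no_simultaneous_solutions[OF assms(2), of "\<lambda>n. \<phi> (g n)" "\<lambda>n. \<phi> (x n)",
      OF hom_closed[OF g(1)] g(2) hom_closed[OF x(1)] xH]
  obtain N :: "nat \<Rightarrow> nat" where N: "\<And>i w. (\<And>n. w n \<in> carrier H) \<Longrightarrow>
      \<exists>n. w n \<noteq> slender_step H (\<phi> (g (i n))) (n * N (i n) + 2) (w (Suc n))"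
    by blast
  define idx where "idx = rec_nat 0 (\<lambda>n i. Suc (i + (n * N i + 2)))"
  define k where "k n = n * N (idx n) + 2" for n
  have idx_Suc: "idx (Suc n) = Suc (idx n + k n)" for n
    by (simp add: idx_def k_def)
  have idx: "j < n \<Longrightarrow> idx j < idx n \<and> k j \<le> idx n" for j n
    by (induction n) (auto simp: idx_Suc less_Suc_eq)
  have idx_ge: "n \<le> idx n" for n
    by (induction n) (auto simp: idx_Suc)
  have "\<exists>w. \<forall>n. w n \<in> carrier G \<and> w n = slender_step G (g (idx n)) (k n) (w (Suc n))"
    using g idx idx_ge by (intro solve gV) auto
  then obtain w where w: "\<And>n. w n \<in> carrier G"
      "\<And>n. w n = slender_step G (g (idx n)) (k n) (w (Suc n))"
    by blast
  obtain n where
    "\<phi> (w n) \<noteq> slender_step H (\<phi> (g (idx n))) (n * N (idx n) + 2) (\<phi> (w (Suc n)))"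
    using N[of "\<lambda>n. \<phi> (w n)" idx] hom_closed[OF w(1)] by blast
  then show False
    using hom_slender_step[OF g(1)[of "idx n"] w(1)[of "Suc n"], of "k n"] w(2)[of n]
    by (simp add: k_def)
qed

section \<open>Topological groups\<close>

definition slender_comp :: "('a, 'm) monoid_scheme \<Rightarrow> ('a \<times> nat) list \<Rightarrow> 'a \<Rightarrow> 'a" where
  "slender_comp G ps y = foldr (\<lambda>p. slender_step G (fst p) (snd p)) ps y"

lemma slender_comp_Nil [simp]: "slender_comp G [] y = y"
  and slender_comp_Cons [simp]:
    "slender_comp G (p # ps) y = slender_step G (fst p) (snd p) (slender_comp G ps y)"
  and slender_comp_append [simp]:
    "slender_comp G (ps @ qs) y = slender_comp G ps (slender_comp G qs y)"
  by (simp_all add: slender_comp_def)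

lemma (in group) slender_comp_closed [simp]:
  "set ps \<subseteq> carrier G \<times> UNIV \<Longrightarrow> y \<in> carrier G \<Longrightarrow> slender_comp G ps y \<in> carrier G"
  by (induction ps) auto

lemma (in group) slender_step_one_one [simp]: "slender_step G \<one> k \<one> = \<one>"
  by (simp add: slender_step_def)

lemma (in group) slender_step_one_min:
  "g \<in> carrier G \<Longrightarrow> slender_step G g (min k 1) \<one> = slender_step G g k \<one>"
  by (auto simp: slender_step_def)

locale top_group =
  fixes G :: "'a monoid" (structure) and T
  assumes top_group: "topological_group G T"
begin

sublocale group G
  using top_group by (simp add: topological_group_def)

lemma topspace [simp]: "topspace T = carrier G"
  using top_group by (simp add: topological_group_def)

lemma continuous_map_mult:
  assumes "continuous_map Z T f" "continuous_map Z T f'"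
  shows "continuous_map Z T (\<lambda>x. f x \<otimes>\<^bsub>G\<^esub> f' x)"
proof -
  have "continuous_map (prod_topology T T) T (\<lambda>(x, y). x \<otimes>\<^bsub>G\<^esub> y)"
    using top_group by (simp add: topological_group_def)
  from continuous_map_compose[OF continuous_map_pairedI[OF assms] this]
  show ?thesis by (simp add: o_def)
qed

lemma continuous_map_inv:
  assumes "continuous_map Z T f"
  shows "continuous_map Z T (\<lambda>x. inv\<^bsub>G\<^esub> f x)"
proof -
  have "continuous_map T T (\<lambda>x. inv\<^bsub>G\<^esub> x)"
    using top_group by (simp add: topological_group_def)
  from continuous_map_compose[OF assms this] show ?thesis by (simp add: o_def)
qed

lemma continuous_map_pow:
  assumes "continuous_map Z T f"
  shows "continuous_map Z T (\<lambda>x. f x [^]\<^bsub>G\<^esub> (n::nat))"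
  by (induction n) (auto intro: continuous_map_mult assms)

lemma continuous_map_slender_step:
  assumes "continuous_map Z T f" "continuous_map Z T f'"
  shows "continuous_map Z T (\<lambda>x. slender_step G (f x) k (f' x))"
  unfolding slender_step_def
  by (cases "k = 0"; simp; intro continuous_map_mult continuous_map_inv continuous_map_pow assms)

lemma continuous_map_slender_comp:
  assumes "continuous_map Z T f" "set ps \<subseteq> carrier G \<times> UNIV"
  shows "continuous_map Z T (\<lambda>x. slender_comp G ps (f x))"
  using assms(2) by (induction ps) (auto intro: continuous_map_slender_step assms(1))

text \<open>The next approximation \<open>slender_comp G qs (slender_step G g k \<one>)\<close> of each component of the
  solution has to lie in a prescribed open set around the current one. Since
  \<open>slender_step G g k \<one>\<close> is \<open>g\<close> for every \<open>k > 0\<close>, two values of \<open>k\<close> suffice.\<close>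

definition strategy where
  "strategy U ps = {g \<in> carrier G. \<forall>n\<le>length ps. \<forall>j\<le>1.
     slender_comp G (drop n ps) (slender_step G g j \<one>\<^bsub>G\<^esub>)
       \<in> U (length ps) (slender_comp G (drop n ps) \<one>\<^bsub>G\<^esub>)}"

text \<open>At \<open>g = \<one>\<close> the new approximation equals the current one, since
  \<open>slender_step G \<one> j \<one> = \<one>\<close>. Continuity then gives a neighbourhood for
  each of the finitely many pairs \<open>n\<close>, \<open>j\<close>.\<close>

lemma eventually_strategy:
  assumes U: "\<And>m y. y \<in> carrier G \<Longrightarrow> openin T (U m y) \<and> y \<in> U m y"
    and ps: "set ps \<subseteq> carrier G \<times> UNIV"
  shows "eventually (\<lambda>g. g \<in> strategy U ps) (nhdsin T \<one>\<^bsub>G\<^esub>)"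
proof -
  let ?Q = "\<lambda>n j g. g \<in> carrier G \<and> slender_comp G (drop n ps) (slender_step G g j \<one>\<^bsub>G\<^esub>)
       \<in> U (length ps) (slender_comp G (drop n ps) \<one>\<^bsub>G\<^esub>)"
  have "eventually (?Q n j) (nhdsin T \<one>\<^bsub>G\<^esub>)" for n j
  proof -
    have dps: "set (drop n ps) \<subseteq> carrier G \<times> UNIV"
      using ps set_drop_subset by fastforce
    let ?f = "\<lambda>g. slender_comp G (drop n ps) (slender_step G g j \<one>\<^bsub>G\<^esub>)"
    have "continuous_map T T ?f"
      using dps by (intro continuous_map_slender_comp continuous_map_slender_step) auto
    moreover have "openin T (U (length ps) (slender_comp G (drop n ps) \<one>\<^bsub>G\<^esub>))"
      using U dps by simp
    ultimately have "openin T {g \<in> topspace T. ?f g \<in> U (length ps) (slender_comp G (drop n ps) \<one>\<^bsub>G\<^esub>)}"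
      by (rule openin_continuous_map_preimage)
    moreover have "?f \<one>\<^bsub>G\<^esub> \<in> U (length ps) (slender_comp G (drop n ps) \<one>\<^bsub>G\<^esub>)"
      using U dps by simp
    ultimately show ?thesis
      unfolding eventually_nhdsin by auto
  qed
  then have "eventually (\<lambda>g. \<forall>n\<in>{..length ps}. \<forall>j\<in>{..1}. ?Q n j g) (nhdsin T \<one>\<^bsub>G\<^esub>)"
    by (intro eventually_ball_finite ballI) auto
  then show ?thesis
    by (rule eventually_mono) (auto simp: strategy_def)
qed

text \<open>The value of \<open>x n\<close> found by backward substitution from
  \<open>x m = \<one>\<close>.\<close>

definition approx where
  "approx g k n m = slender_comp G (map (\<lambda>i. (g i, k i)) [n..<m]) \<one>\<^bsub>G\<^esub>"

context
  fixes U g k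
  assumes g: "\<And>m :: nat. g m \<in> carrier G"
    and strat: "\<And>m. g m \<in> strategy U (map (\<lambda>i. (g i, k i)) [0..<m])"
begin

lemma approx_closed [simp]: "approx g k n m \<in> carrier G"
  unfolding approx_def using g by (intro slender_comp_closed) auto

lemma approx_step: "n < m \<Longrightarrow> approx g k n m = slender_step G (g n) (k n) (approx g k (Suc n) m)"
  by (simp add: approx_def upt_conv_Cons)

lemma approx_refl: "m \<le> n \<Longrightarrow> approx g k n m = \<one>\<^bsub>G\<^esub>"
  by (simp add: approx_def)

lemma approx_Suc:
  assumes "n \<le> m"
  shows "approx g k n (Suc m) \<in> U m (approx g k n m)"
proof -
  have "slender_comp G (map (\<lambda>i. (g i, k i)) [n..<m]) (slender_step G (g m) (min (k m) 1) \<one>\<^bsub>G\<^esub>)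
      \<in> U m (approx g k n m)"
    using strat[of m] assms by (auto simp: strategy_def drop_map approx_def)
  moreover have "slender_step G (g m) (min (k m) 1) \<one>\<^bsub>G\<^esub> = slender_step G (g m) (k m) \<one>\<^bsub>G\<^esub>"
    using slender_step_one_min[OF g] by simp
  ultimately show ?thesis using assms by (simp add: approx_def)
qed

end

section \<open>Winning strategies from completeness and from compactness\<close>

definition winning where
  "winning U \<longleftrightarrow> (\<forall>m y. y \<in> carrier G \<longrightarrow> openin T (U m y) \<and> y \<in> U m y) \<and>
    (\<forall>g k. (\<forall>m. g m \<in> carrier G) \<longrightarrow> (\<forall>m. g m \<in> strategy U (map (\<lambda>i. (g i, k i)) [0..<m])) \<longrightarrow>
      (\<exists>x. \<forall>n. x n \<in> carrier G \<and> x n = slender_step G (g n) (k n) (x (Suc n))))"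

text \<open>Balls of radius \<open>(1/2)^m\<close> make the approximations of each unknown a Cauchy
  sequence; the limits solve the system by continuity of the step and uniqueness of limits.\<close>

lemma completely_metrizable_strategy:
  assumes "completely_metrizable_space T"
  shows "\<exists>U. winning U"
proof -
  obtain M d where "Metric_space M d" and complete: "Metric_space.mcomplete M d"
    and T: "T = Metric_space.mtopology M d"
    using assms unfolding completely_metrizable_space_def by blast
  interpret Metric_space M d by fact
  have M: "M = carrier G" using topspace T by simp
  let ?U = "\<lambda>m y. mball y ((1/2) ^ m)"
  have solve: "\<exists>x. \<forall>n. x n \<in> carrier G \<and> x n = slender_step G (g n) (k n) (x (Suc n))"
    if g: "\<And>m. g m \<in> carrier G"
      and strat: "\<And>m. g m \<in> strategy ?U (map (\<lambda>i. (g i, k i)) [0..<m])" for g and k :: "nat \<Rightarrow> nat"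
  proof -
    note ap = approx_closed[OF g strat] approx_step[OF g strat] approx_Suc[OF g strat]
    let ?y = "approx g k"
    have step: "d (?y n m) (?y n (Suc m)) < (1/2) ^ m" if "n \<le> m" for n m
      using ap(3)[OF that] by simp
    \<comment> \<open>The geometric sum in closed form, so that the induction on \<open>j\<close>
      closes.\<close>
    have dist: "d (?y n m) (?y n (m + j)) \<le> 2 * (1/2) ^ m - 2 * (1/2) ^ (m + j)" if "n \<le> m" for n m j
    proof (induction j)
      case 0
      then show ?case using ap(1) M by simp
    next
      case (Suc j)
      have "d (?y n m) (?y n (m + Suc j)) \<le>
          d (?y n m) (?y n (m + j)) + d (?y n (m + j)) (?y n (m + Suc j))"
        using ap(1) M by (intro triangle) auto
      also have "\<dots> \<le> 2 * (1/2) ^ m - 2 * (1/2) ^ (m + j) + (1/2) ^ (m + j)"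
        using Suc step[of n "m + j"] that by simp
      finally show ?case by simp
    qed
    have "MCauchy (?y n)" for n
      unfolding MCauchy_def
    proof (intro conjI allI impI)
      show "range (?y n) \<subseteq> M" using ap(1) M by auto
      fix e :: real assume "e > 0"
      then obtain N where N: "(1/2) ^ N < e / 2"
        using real_arch_pow_inv[of "e / 2" "1/2"] by auto
      have *: "d (?y n m) (?y n m') < e" if "max n N \<le> m" "m \<le> m'" for m m'
      proof -
        have "d (?y n m) (?y n (m + (m' - m))) \<le> 2 * (1/2) ^ m - 2 * (1/2) ^ (m + (m' - m))"
          using dist[of n m "m' - m"] that by simp
        also have "\<dots> \<le> 2 * (1/2) ^ m" by simp
        finally have "d (?y n m) (?y n m') \<le> 2 * (1/2) ^ m" using that by simp
        moreover have "(1/2::real) ^ m \<le> (1/2) ^ N"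
          using that by (intro power_decreasing) auto
        ultimately show ?thesis using N by linarith
      qed
      show "\<exists>N. \<forall>m m'. N \<le> m \<longrightarrow> N \<le> m' \<longrightarrow> d (?y n m) (?y n m') < e"
      proof (intro exI[of _ "max n N"] allI impI)
        fix m m' assume "max n N \<le> m" "max n N \<le> m'"
        then show "d (?y n m) (?y n m') < e"
          using *[of m m'] *[of m' m] commute by (cases "m \<le> m'") auto
      qed
    qed
    then have "\<exists>x. limitin mtopology (?y n) x sequentially" for n
      using complete unfolding mcomplete_def by blast
    then have "\<exists>x. \<forall>n. limitin T (?y n) (x n) sequentially"
      unfolding T by (intro choice allI)
    then obtain x where x: "\<And>n. limitin T (?y n) (x n) sequentially"
      by blast
    have xC: "x n \<in> carrier G" for n
      using limitin_topspace[OF x[of n]] by simp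
    have "x n = slender_step G (g n) (k n) (x (Suc n))" for n
    proof -
      have "continuous_map T T (\<lambda>z. slender_step G (g n) (k n) z)"
        using g by (intro continuous_map_slender_step) auto
      from continuous_map_limit[OF this x[of "Suc n"]]
      have "limitin T (\<lambda>m. slender_step G (g n) (k n) (?y (Suc n) m))
          (slender_step G (g n) (k n) (x (Suc n))) sequentially"
        by (simp add: o_def)
      moreover have "eventually (\<lambda>m. slender_step G (g n) (k n) (?y (Suc n) m) = ?y n m) sequentially"
        using eventually_gt_at_top[of n] by eventually_elim (simp add: ap(2))
      ultimately have "limitin T (?y n) (slender_step G (g n) (k n) (x (Suc n))) sequentially"
        by (rule limitin_transform_eventually[rotated])
      then show ?thesis
        using x[of n] limitin_metric_unique[of "?y n" _ sequentially] unfolding T by simp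
    qed
    with xC show ?thesis by blast
  qed
  have "openin T (?U m y) \<and> y \<in> ?U m y" if "y \<in> carrier G" for m y
    using that by (simp add: T flip: M)
  with solve show ?thesis unfolding winning_def by (intro exI[of _ ?U] conjI allI impI) auto
qed

text \<open>The strategy keeps all approximations inside a compact set \<open>C\<close>. In a
  product of copies of \<open>C\<close>, the solutions of the first \<open>m\<close> equations form
  decreasing nonempty sets, closed because \<open>T\<close> is Hausdorff.\<close>

lemma locally_compact_strategy:
  assumes "locally_compact_space T" "Hausdorff_space T"
  shows "\<exists>U. winning U"
proof -
  obtain O1 C where O1: "openin T O1" "\<one>\<^bsub>G\<^esub> \<in> O1" "O1 \<subseteq> C" and C: "compactin T C"
    using assms(1) unfolding locally_compact_space_def by (metis one_closed topspace)
  have CG: "C \<subseteq> carrier G" using C compactin_subset_topspace by fastforce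
  \<comment> \<open>Approximations start at \<open>\<one>\<close> and so never leave
    \<open>O1\<close>; the other branch only makes \<open>?U m y\<close> a neighbourhood of every
    \<open>y\<close>.\<close>
  let ?U = "\<lambda>(m::nat) y. if y \<in> O1 then O1 else carrier G"
  have solve: "\<exists>x. \<forall>n. x n \<in> carrier G \<and> x n = slender_step G (g n) (k n) (x (Suc n))"
    if g: "\<And>m. g m \<in> carrier G"
      and strat: "\<And>m. g m \<in> strategy ?U (map (\<lambda>i. (g i, k i)) [0..<m])" for g and k :: "nat \<Rightarrow> nat"
  proof -
    note ap = approx_closed[OF g strat] approx_step[OF g strat] approx_Suc[OF g strat]
      approx_refl[OF g strat]
    let ?y = "approx g k"
    have yO: "?y n m \<in> O1" for n m
    proof (induction m)
      case (Suc m)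
      then show ?case using ap(3)[of n m] ap(4)[of "Suc m" n] O1(2) by (cases "n \<le> m") auto
    qed (use ap(4) O1 in simp)
    define P where "P = product_topology (\<lambda>_::nat. subtopology T C) UNIV"
    define S where "S m = {x \<in> topspace P. \<forall>n<m. x n = slender_step G (g n) (k n) (x (Suc n))}" for m
    have "compact_space P"
      using C by (simp add: P_def compact_space_product_topology compactin_subspace)
    moreover have "closedin P (S m)" for m
    proof (induction m)
      case 0
      then show ?case by (simp add: S_def)
    next
      case (Suc m)
      have proj: "continuous_map P T (\<lambda>x. x n)" for n
        unfolding P_def
        using continuous_map_product_projection[of n UNIV "\<lambda>_. subtopology T C"]
        by (simp add: continuous_map_in_subtopology)
      have "closedin P {x \<in> topspace P. x m = slender_step G (g m) (k m) (x (Suc m))}"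
        using g by (intro closedin_continuous_maps_eq[OF assms(2)] continuous_map_slender_step proj) auto
      moreover have "S (Suc m) =
          S m \<inter> {x \<in> topspace P. x m = slender_step G (g m) (k m) (x (Suc m))}"
        by (auto simp: S_def less_Suc_eq)
      ultimately show ?case using Suc by auto
    qed
    moreover have "S m \<noteq> {}" for m
    proof -
      \<comment> \<open>The truncation at \<open>m\<close> solves the equations below
        \<open>m\<close> and is constantly \<open>\<one>\<close> from index \<open>m\<close>
        on.\<close>
      have "(\<lambda>n. ?y n m) \<in> S m"
        using yO O1 CG ap(2)[of _ m] by (auto simp: S_def P_def)
      then show ?thesis by blast
    qed
    moreover have "decseq S" by (auto simp: decseq_def S_def)
    ultimately have "(\<Inter>m. S m) \<noteq> {}" by (rule compact_space_imp_nest)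
    then obtain x where x: "\<And>m. x \<in> S m" by auto
    then have "x n \<in> carrier G" for n
      using x[of 0] CG by (auto simp: S_def P_def)
    moreover have "x n = slender_step G (g n) (k n) (x (Suc n))" for n
      using x[of "Suc n"] unfolding S_def by blast
    ultimately show ?thesis by blast
  qed
  have "openin T (?U m y) \<and> y \<in> ?U m y" if "y \<in> carrier G" for m y
    using O1 openin_topspace[of T] that by simp
  with solve show ?thesis unfolding winning_def by (intro exI[of _ ?U] conjI allI impI) auto
qed

text \<open>Triviality near \<open>\<one>\<close> spreads to every point of the kernel by left
  translation.\<close>

lemma openin_kernel_of_strategy:
  fixes H :: "('h, 'm) monoid_scheme"
  assumes H: "aleph1_free H" and hom: "\<phi> \<in> hom G H"
    and U: "winning U"
  shows "openin T (kernel G H \<phi>)"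
proof -
  have grp: "group G" by (rule is_group)
  interpret group_hom G H \<phi>
    using H hom by (simp add: group_hom_def group_hom_axioms_def aleph1_free_def is_group)
  have "eventually (\<lambda>g. \<phi> g = \<one>\<^bsub>H\<^esub>) (nhdsin T \<one>\<^bsub>G\<^esub>)"
  proof (rule aleph1_free_hom_eventually_trivial[OF _ H hom, of "strategy U"])
    show "eventually (\<lambda>g. g \<in> carrier G) (nhdsin T \<one>\<^bsub>G\<^esub>)"
      unfolding eventually_nhdsin using openin_topspace[of T] one_closed topspace by metis
    show "eventually (\<lambda>g. g \<in> strategy U ps) (nhdsin T \<one>\<^bsub>G\<^esub>)" if "set ps \<subseteq> carrier G \<times> UNIV" for ps
      using U that unfolding winning_def by (intro eventually_strategy) auto
    show "\<exists>x. \<forall>n. x n \<in> carrier G \<and> x n = slender_step G (g n) (k n) (x (Suc n))"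
      if "\<And>m. g m \<in> carrier G" "\<And>m. g m \<in> strategy U (map (\<lambda>i. (g i, k i)) [0..<m])" for g k
      using U that unfolding winning_def by blast
  qed (rule grp)
  then obtain W where W: "openin T W" "\<one>\<^bsub>G\<^esub> \<in> W" "\<And>g. g \<in> W \<Longrightarrow> \<phi> g = \<one>\<^bsub>H\<^esub>"
    unfolding eventually_nhdsin using one_closed topspace by blast
  show ?thesis
  proof (subst openin_subopen, intro ballI)
    fix a assume "a \<in> kernel G H \<phi>"
    then have a: "a \<in> carrier G" "\<phi> a = \<one>\<^bsub>H\<^esub>" by (auto simp: kernel_def)
    have "continuous_map T T (\<lambda>z. inv\<^bsub>G\<^esub> a \<otimes>\<^bsub>G\<^esub> z)"
      using a by (intro continuous_map_mult) auto
    then have "openin T {z \<in> topspace T. inv\<^bsub>G\<^esub> a \<otimes>\<^bsub>G\<^esub> z \<in> W}"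
      using W(1) by (rule openin_continuous_map_preimage)
    moreover have "{z \<in> topspace T. inv\<^bsub>G\<^esub> a \<otimes>\<^bsub>G\<^esub> z \<in> W} \<subseteq> kernel G H \<phi>"
    proof clarify
      fix z assume z: "z \<in> topspace T" "inv\<^bsub>G\<^esub> a \<otimes>\<^bsub>G\<^esub> z \<in> W"
      then have "\<one>\<^bsub>H\<^esub> = inv\<^bsub>H\<^esub> \<phi> a \<otimes>\<^bsub>H\<^esub> \<phi> z" using W(3) a by fastforce
      then show "z \<in> kernel G H \<phi>" using a z by (simp add: kernel_def)
    qed
    ultimately show "\<exists>S. openin T S \<and> a \<in> S \<and> S \<subseteq> kernel G H \<phi>"
      using a W(2) by (intro exI[of _ "{z \<in> topspace T. inv\<^bsub>G\<^esub> a \<otimes>\<^bsub>G\<^esub> z \<in> W}"]) auto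
  qed
qed

end

lemma aleph1_free_cm_slender:
  assumes "aleph1_free H"
  shows "cm_slender TYPE('b) H"
  unfolding cm_slender_def
proof (intro allI impI, elim conjE)
  fix G :: "'b monoid" and T \<phi>
  assume *: "topological_group G T" "completely_metrizable_space T" "\<phi> \<in> hom G H"
  interpret top_group G T by standard fact
  show "openin T (kernel G H \<phi>)"
    using completely_metrizable_strategy[OF *(2)] openin_kernel_of_strategy[OF assms *(3)] by blast
qed

lemma aleph1_free_lcH_slender:
  assumes "aleph1_free H"
  shows "lcH_slender TYPE('b) H"
  unfolding lcH_slender_def
proof (intro allI impI, elim conjE)
  fix G :: "'b monoid" and T \<phi>
  assume *: "topological_group G T" "locally_compact_space T" "Hausdorff_space T" "\<phi> \<in> hom G H"
  interpret top_group G T by standard fact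
  show "openin T (kernel G H \<phi>)"
    using locally_compact_strategy[OF *(2,3)] openin_kernel_of_strategy[OF assms *(4)] by blast
qed

section \<open>The Hawaiian earring group\<close>

lemma HE_word_subset:
  assumes "HE_word D W" "D' \<subseteq> D"
  shows "HE_word D' W"
  unfolding HE_word_def
proof
  fix m
  have "{i \<in> D'. fst (W i) \<le> m} \<subseteq> {i \<in> D. fst (W i) \<le> m}" using assms(2) by auto
  then show "finite {i \<in> D'. fst (W i) \<le> m}"
    using assms(1) finite_subset by (auto simp: HE_word_def)
qed

lemma HE_proj_eq_Nil:
  assumes "\<And>i. i \<in> D \<Longrightarrow> m < fst (W i)" "j \<le> m"
  shows "HE_proj j D W = []"
proof -
  have "{i \<in> D. fst (W i) \<le> j} = {}" using assms by force
  then show ?thesis unfolding HE_proj_def by (simp only:) simp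
qed

text \<open>Coherent sequences of finite words encode the elements of \<open>HE\<close> without embedding an arbitrary
  countable order into the rationals: the letters of each level are inserted between those already
  placed, one level at a time.\<close>

definition coherent :: "(nat \<Rightarrow> (nat \<times> bool) list) \<Rightarrow> bool" where
  "coherent v \<longleftrightarrow> (\<forall>m. filter (\<lambda>l. fst l \<le> m) (v (Suc m)) = v m)"

lemma coherent_HE_proj:
  assumes "HE_word D W"
  shows "coherent (\<lambda>m. HE_proj m D W)"
  unfolding coherent_def
proof
  fix m
  let ?A = "{i \<in> D. fst (W i) \<le> Suc m}"
  let ?xs = "filter (\<lambda>i. fst (W i) \<le> m) (sorted_list_of_set ?A)"
  have "finite ?A" using assms by (simp add: HE_word_def)
  then have "set ?xs = {i \<in> D. fst (W i) \<le> m}" by auto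
  moreover have "sorted_list_of_set (set ?xs) = ?xs"
    by (intro sorted_list_of_set.idem_if_sorted_distinct sorted_wrt_filter distinct_filter) auto
  ultimately show "filter (\<lambda>l. fst l \<le> m) (HE_proj (Suc m) D W) = HE_proj m D W"
    by (simp add: HE_proj_def filter_map o_def)
qed

lemma finite_rat_lower_bound: "finite A \<Longrightarrow> \<exists>b :: rat. \<forall>q\<in>A. b < q"
proof (induction rule: finite_induct)
  case (insert x A)
  then obtain b where "\<forall>q\<in>A. b < q" by blast
  then show ?case by (intro exI[of _ "min b (x - 1)"]) (auto simp: min_less_iff_disj)
qed simp

text \<open>Old letters keep their positions, so one level extends the previous one. The bound
  \<open>b\<close> advances along \<open>v\<close> in the induction, and a new letter goes between
  \<open>b\<close> and the next old position by density of the rationals.\<close>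

lemma insert_letters:
  fixes ps :: "(rat \<times> 'l) list"
  assumes "sorted_wrt (<) (map fst ps)" "\<forall>q\<in>fst ` set ps. b < q" "map snd ps = filter P v"
  shows "\<exists>ps'. sorted_wrt (<) (map fst ps') \<and> (\<forall>q\<in>fst ` set ps'. b < q) \<and> map snd ps' = v \<and>
    filter (\<lambda>p. P (snd p)) ps' = ps"
  using assms
proof (induction v arbitrary: ps b)
  case Nil
  then show ?case by (intro exI[of _ "[]"]) auto
next
  case (Cons l v)
  show ?case
  proof (cases "P l")
    case True
    then obtain q ps2 where ps: "ps = (q, l) # ps2" "map snd ps2 = filter P v"
      using Cons.prems(3) by (cases ps) auto
    then obtain ps' where ps': "sorted_wrt (<) (map fst ps')" "\<forall>r\<in>fst ` set ps'. q < r"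
        "map snd ps' = v" "filter (\<lambda>p. P (snd p)) ps' = ps2"
      using Cons.IH[of ps2 q] Cons.prems by auto
    then show ?thesis
      using True ps Cons.prems by (intro exI[of _ "(q, l) # ps'"]) force
  next
    case False
    obtain q where q: "b < q" "\<forall>r\<in>fst ` set ps. q < r"
    proof (cases ps)
      case Nil
      then show thesis using that[of "b + 1"] by simp
    next
      case (Cons p ps2)
      obtain q where "b < q" "q < fst p"
        using Cons.prems Cons dense[of b "fst p"] by auto
      then show thesis using that[of q] Cons.prems Cons by fastforce
    qed
    then obtain ps' where ps': "sorted_wrt (<) (map fst ps')" "\<forall>r\<in>fst ` set ps'. q < r"
        "map snd ps' = v" "filter (\<lambda>p. P (snd p)) ps' = ps"
      using Cons.IH[of ps q] Cons.prems False by auto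
    then show ?thesis
      using False q by (intro exI[of _ "(q, l) # ps'"]) force
  qed
qed

text \<open>Positions are chosen level by level with dependent choice; as the levels are nested,
  their union carries one word with all the prescribed projections.\<close>

lemma coherent_realizable:
  assumes "coherent v"
  shows "\<exists>D W. HE_word D W \<and> (\<forall>m. HE_proj m D W = v m)"
proof -
  define good where "good m ps \<longleftrightarrow> sorted_wrt (<) (map fst ps) \<and> map snd ps = v m"
    for m and ps :: "(rat \<times> nat \<times> bool) list"
  have "\<exists>ps. \<forall>m. good m (ps m) \<and> filter (\<lambda>p. fst (snd p) \<le> m) (ps (Suc m)) = ps m"
  proof (rule dependent_nat_choice)
    \<comment> \<open>At level \<open>0\<close> every letter is new, hence the constantly false
      predicate.\<close>
    show "\<exists>ps. good 0 ps"
      using insert_letters[of "[]" 0 "\<lambda>_. False" "v 0"] by (auto simp: good_def)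
  next
    fix ps m assume ps: "good m ps"
    obtain b where "\<forall>q\<in>fst ` set ps. b < q" using finite_rat_lower_bound[of "fst ` set ps"] by auto
    moreover have "map snd ps = filter (\<lambda>l. fst l \<le> m) (v (Suc m))"
      using ps assms by (simp add: good_def coherent_def)
    ultimately show "\<exists>ps'. good (Suc m) ps' \<and> filter (\<lambda>p. fst (snd p) \<le> m) ps' = ps"
      using insert_letters[of ps b "\<lambda>l. fst l \<le> m" "v (Suc m)"] ps by (auto simp: good_def)
  qed
  then obtain ps :: "nat \<Rightarrow> (rat \<times> nat \<times> bool) list" where ps: "\<And>m. sorted_wrt (<) (map fst (ps m))" "\<And>m. map snd (ps m) = v m"
      "\<And>m. filter (\<lambda>p. fst (snd p) \<le> m) (ps (Suc m)) = ps m"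
    unfolding good_def by blast
  have sub: "set (ps m) \<subseteq> set (ps n)" if "m \<le> n" for m n
    using that
  proof (induction rule: dec_induct)
    case (step n)
    then show ?case by (subst (asm) ps(3)[symmetric]) auto
  qed simp
  have letter_le: "fst (snd p) \<le> m" if "p \<in> set (ps m)" for p m
    using that by (subst (asm) ps(3)[symmetric]) simp
  \<comment> \<open>Level \<open>Suc n\<close> adds only letters of index above
    \<open>n\<close>.\<close>
  have down: "p \<in> set (ps m)" if "p \<in> set (ps n)" "fst (snd p) \<le> m" for p m n
  proof (cases "n \<le> m")
    case False
    then have "m \<le> n" by simp
    then show ?thesis using that(1)
    proof (induction rule: dec_induct)
      case (step n)
      then have "p \<in> set (filter (\<lambda>p. fst (snd p) \<le> n) (ps (Suc n)))" using that(2) by simp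
      then show ?case using step by (simp add: ps(3))
    qed
  qed (use that sub in blast)
  have dist: "distinct (map fst (ps m))" for m
    using ps(1)[of m] strict_sorted_iff by blast
  define D where "D = (\<Union>m. fst ` set (ps m))"
  \<comment> \<open>The choice is unambiguous, as the levels are nested and each has distinct
    positions.\<close>
  define W where "W q = (SOME l. \<exists>m. (q, l) \<in> set (ps m))" for q
  have W: "W q = l" if "(q, l) \<in> set (ps m)" for q l m
    unfolding W_def
  proof (rule some_equality)
    fix l' assume "\<exists>m. (q, l') \<in> set (ps m)"
    then obtain n where "(q, l') \<in> set (ps n)" by blast
    then have "(q, l) \<in> set (ps (max m n))" "(q, l') \<in> set (ps (max m n))"
      using that sub[of m "max m n"] sub[of n "max m n"] by auto
    then show "l' = l" using dist eq_key_imp_eq_value by metis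
  qed (use that in blast)
  have set: "{i \<in> D. fst (W i) \<le> m} = set (map fst (ps m))" for m
  proof (intro equalityI subsetI)
    fix q assume "q \<in> {i \<in> D. fst (W i) \<le> m}"
    then obtain l n where "(q, l) \<in> set (ps n)" "fst (W q) \<le> m" by (auto simp: D_def)
    then have "(q, l) \<in> set (ps m)" using W down by fastforce
    then show "q \<in> set (map fst (ps m))" by force
  next
    fix q assume "q \<in> set (map fst (ps m))"
    then obtain l where "(q, l) \<in> set (ps m)" by auto
    then have "W q = l" "fst l \<le> m"
      using W letter_le[of "(q, l)"] by auto
    moreover have "q \<in> D"
      using \<open>q \<in> set (map fst (ps m))\<close> unfolding D_def by auto
    ultimately show "q \<in> {i \<in> D. fst (W i) \<le> m}" by simp
  qed
  have "HE_proj m D W = v m" for m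
  proof -
    have "sorted_list_of_set (set (map fst (ps m))) = map fst (ps m)"
      using ps(1)[of m] dist by (intro sorted_list_of_set.idem_if_sorted_distinct)
        (auto simp: strict_sorted_iff)
    moreover have "map W (map fst (ps m)) = map snd (ps m)"
      using W by auto
    ultimately show ?thesis by (simp only: HE_proj_def set ps(2))
  qed
  moreover have "HE_word D W" unfolding HE_word_def set by simp
  ultimately show ?thesis by blast
qed

section \<open>The group law on coherent sequences\<close>

definition he :: "(nat \<Rightarrow> (nat \<times> bool) list) \<Rightarrow> nat \<Rightarrow> (nat \<times> bool) list" where
  "he v m = reduce_word (v m)"

lemma carrier_HE: "carrier HE = he ` Collect coherent"
proof -
  have "HE_carrier = he ` Collect coherent"
  proof (intro equalityI subsetI)
    fix f assume "f \<in> HE_carrier"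
    then obtain D W where "HE_word D W" "\<And>m. f m = reduce_word (HE_proj m D W)"
      by (auto simp: HE_carrier_def)
    then show "f \<in> he ` Collect coherent"
      by (intro image_eqI[of _ _ "\<lambda>m. HE_proj m D W"]) (auto simp: he_def coherent_HE_proj)
  next
    fix f assume "f \<in> he ` Collect coherent"
    then obtain v where v: "coherent v" "f = he v" by blast
    then obtain D W where "HE_word D W" "\<forall>m. HE_proj m D W = v m"
      using coherent_realizable by blast
    then show "f \<in> HE_carrier"
      using v by (auto simp: HE_carrier_def he_def intro!: exI[of _ D] exI[of _ W])
  qed
  then show ?thesis by (simp add: HE_def)
qed

lemma one_HE: "\<one>\<^bsub>HE\<^esub> = he (\<lambda>_. [])"
  by (simp add: HE_def he_def reduce_word_def fun_eq_iff)

lemma mult_he: "he u \<otimes>\<^bsub>HE\<^esub> he v = he (\<lambda>m. u m @ v m)"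
  by (simp add: HE_def he_def fun_eq_iff)

lemma coherent_Nil [simp]: "coherent (\<lambda>_. [])"
  by (simp add: coherent_def)

lemma coherent_append [simp]: "coherent u \<Longrightarrow> coherent v \<Longrightarrow> coherent (\<lambda>m. u m @ v m)"
  by (simp add: coherent_def)

lemma coherent_inv_word [simp]: "coherent v \<Longrightarrow> coherent (\<lambda>m. inv_word (v m))"
  by (simp add: coherent_def filter_inv_word[where P = "\<lambda>x. x \<le> m" for m])

lemma he_carrier [simp]: "coherent v \<Longrightarrow> he v \<in> carrier HE"
  by (simp add: carrier_HE)

lemma inv_he_mult: "he (\<lambda>m. inv_word (v m)) \<otimes>\<^bsub>HE\<^esub> he v = \<one>\<^bsub>HE\<^esub>"
  by (simp add: mult_he one_HE he_def fun_eq_iff reduce_word_def[of "[]"])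

lemma group_HE: "group HE"
proof (rule groupI)
  fix x y z
  assume "x \<in> carrier HE" "y \<in> carrier HE" "z \<in> carrier HE"
  then show "x \<otimes>\<^bsub>HE\<^esub> y \<otimes>\<^bsub>HE\<^esub> z = x \<otimes>\<^bsub>HE\<^esub> (y \<otimes>\<^bsub>HE\<^esub> z)"
    by (auto simp: carrier_HE mult_he)
next
  fix x assume "x \<in> carrier HE"
  then obtain v where "coherent v" "x = he v" by (auto simp: carrier_HE)
  then show "\<exists>y\<in>carrier HE. y \<otimes>\<^bsub>HE\<^esub> x = \<one>\<^bsub>HE\<^esub>"
    by (intro bexI[of _ "he (\<lambda>m. inv_word (v m))"]) (simp_all add: inv_he_mult)
qed (auto simp: carrier_HE mult_he one_HE)

interpretation HE: group HE by (rule group_HE)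

lemma inv_he: "coherent v \<Longrightarrow> inv\<^bsub>HE\<^esub> (he v) = he (\<lambda>m. inv_word (v m))"
  by (rule HE.inv_equality[OF inv_he_mult]) auto

lemma coherent_power [simp]: "coherent v \<Longrightarrow> coherent (\<lambda>m. concat (replicate k (v m)))"
  by (induction k) auto

lemma pow_he: "coherent v \<Longrightarrow> he v [^]\<^bsub>HE\<^esub> (k::nat) = he (\<lambda>m. concat (replicate k (v m)))"
proof (induction k)
  case (Suc k)
  then have "he v [^]\<^bsub>HE\<^esub> Suc k = he (\<lambda>m. v m @ concat (replicate k (v m)))"
    by (subst HE.nat_pow_Suc2) (simp_all add: mult_he)
  then show ?case by simp
qed (simp add: one_HE)

text \<open>Left unreduced on purpose: deleting letters from a reduced word may create
  cancellations, so reduced forms need not be coherent.\<close>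

definition slender_word :: "(nat \<times> bool) list \<Rightarrow> nat \<Rightarrow> (nat \<times> bool) list \<Rightarrow> (nat \<times> bool) list" where
  "slender_word v k x =
     (if k = 0 then x @ v @ inv_word x @ concat (replicate 4 v) else v @ concat (replicate k x))"

lemma slender_step_he:
  "coherent v \<Longrightarrow> coherent x \<Longrightarrow>
     slender_step HE (he v) k (he x) = he (\<lambda>m. slender_word (v m) k (x m))"
  by (simp add: slender_step_def slender_word_def mult_he inv_he pow_he)

lemma filter_slender_word:
  "filter (\<lambda>l. P (fst l)) (slender_word v k x) =
     slender_word (filter (\<lambda>l. P (fst l)) v) k (filter (\<lambda>l. P (fst l)) x)"
  by (simp add: slender_word_def filter_inv_word filter_concat map_replicate)

text \<open>These sets act as basic neighbourhoods of the identity, although no topology is put on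
  \<open>HE\<close>.\<close>

definition HE_tail :: "nat \<Rightarrow> (nat \<Rightarrow> (nat \<times> bool) list) set" where
  "HE_tail m = {he v | v. coherent v \<and> (\<forall>j\<le>m. v j = [])}"

text \<open>The \<open>j\<close>-th projection of the solution only involves the first \<open>j\<close> equations.\<close>

lemma HE_tail_solution:
  assumes g: "\<And>m. g m \<in> HE_tail m"
  shows "\<exists>x. \<forall>n. x n \<in> carrier HE \<and> x n = slender_step HE (g n) (k n) (x (Suc n))"
proof -
  obtain v where v: "\<And>m. g m = he (v m)" "\<And>m. coherent (v m)" "\<And>m j. j \<le> m \<Longrightarrow> v m j = []"
    using g unfolding HE_tail_def by simp metis
  \<comment> \<open>Stopping at \<open>j\<close> loses nothing: \<open>v i j\<close> is empty for
    \<open>i \<ge> j\<close>, and the step with empty data returns the empty word.\<close>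
  define y where "y n j = foldr (\<lambda>i. slender_word (v i j) (k i)) [n..<j] []" for n j
  have Nil: "slender_word [] (k n) [] = []" for n
    by (simp add: slender_word_def)
  have y: "y n j = slender_word (v n j) (k n) (y (Suc n) j)" for n j
    by (cases "n < j") (simp_all add: y_def upt_conv_Cons v(3) Nil)
  have "coherent (y n)" for n
    unfolding coherent_def
  proof
    fix j
    have fil: "filter (\<lambda>l. fst l \<le> j) (foldr (\<lambda>i. slender_word (v i (Suc j)) (k i)) is w) =
        foldr (\<lambda>i. slender_word (v i j) (k i)) is (filter (\<lambda>l. fst l \<le> j) w)" for "is" w
      using v(2) by (induction "is")
        (simp_all add: filter_slender_word[where P = "\<lambda>x. x \<le> j"] coherent_def)
    show "filter (\<lambda>l. fst l \<le> j) (y n (Suc j)) = y n j"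
      unfolding y_def fil by (cases "n \<le> j") (simp_all add: v(3) Nil)
  qed
  then have sol: "he (y n) \<in> carrier HE \<and> he (y n) = slender_step HE (g n) (k n) (he (y (Suc n)))" for n
    using v by (simp add: slender_step_he flip: y)
  show ?thesis by (rule exI[of _ "\<lambda>n. he (y n)"], rule allI, rule sol)
qed

section \<open>From triviality on tails to n-slenderness\<close>

lemma HE_proj_Un:
  assumes "HE_word (D1 \<union> D2) W" "\<And>x y. x \<in> D1 \<Longrightarrow> y \<in> D2 \<Longrightarrow> x < y"
  shows "HE_proj m (D1 \<union> D2) W = HE_proj m D1 W @ HE_proj m D2 W"
proof -
  let ?A = "\<lambda>D. {i \<in> D. fst (W i) \<le> m}"
  have fin: "finite (?A (D1 \<union> D2))" using assms(1) by (simp add: HE_word_def)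
  then have fin12: "finite (?A D1)" "finite (?A D2)"
    by (auto elim: rev_finite_subset)
  let ?xs = "sorted_list_of_set (?A D1) @ sorted_list_of_set (?A D2)"
  have "sorted_list_of_set (set ?xs) = ?xs"
  proof (rule sorted_list_of_set.idem_if_sorted_distinct)
    show "sorted ?xs" using fin12 assms(2) by (auto simp: sorted_append less_imp_le)
    show "distinct ?xs" using fin12 assms(2) by (auto dest: assms(2))
  qed
  moreover have "set ?xs = ?A (D1 \<union> D2)" using fin12 by auto
  ultimately show ?thesis by (simp add: HE_proj_def)
qed

text \<open>Once \<open>\<phi>\<close> is trivial on \<open>HE_tail m\<close>, a word is cut at its
  finitely many letters of index at most \<open>m\<close>: the pieces in between vanish under both
  \<open>\<phi>\<close> and \<open>HE_retr m\<close>.\<close>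

lemma aleph1_free_n_slender:
  assumes H: "aleph1_free H"
  shows "n_slender H"
  unfolding n_slender_def
proof (rule ballI)
  fix \<phi> assume hom: "\<phi> \<in> hom HE H"
  interpret group_hom HE H \<phi>
    using H hom by (simp add: group_hom_def group_hom_axioms_def aleph1_free_def group_HE)
  define F where "F = (INF m. principal (HE_tail m))"
  have mono: "HE_tail n \<subseteq> HE_tail m" if "m \<le> n" for m n
    using that by (fastforce simp: HE_tail_def)
  have ev: "eventually P F \<longleftrightarrow> (\<exists>m. \<forall>f\<in>HE_tail m. P f)" for P
    unfolding F_def
  proof (subst eventually_INF_base)
    show "\<exists>x\<in>UNIV. principal (HE_tail x) \<le> inf (principal (HE_tail a)) (principal (HE_tail b))"
      for a b using mono[of a "max a b"] mono[of b "max a b"] by (intro bexI[of _ "max a b"]) auto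
  qed (auto simp: eventually_principal)
  have "eventually (\<lambda>g. \<phi> g = \<one>\<^bsub>H\<^esub>) F"
  proof (rule aleph1_free_hom_eventually_trivial[OF group_HE H hom, of "\<lambda>ps. HE_tail (length ps)"])
    show "eventually (\<lambda>g. g \<in> HE_tail (length ps)) F" for ps :: "((nat \<Rightarrow> (nat \<times> bool) list) \<times> nat) list"
      unfolding ev by blast
    show "eventually (\<lambda>g. g \<in> carrier HE) F"
      unfolding ev by (auto simp: HE_tail_def)
  qed (rule HE_tail_solution, simp)
  then obtain m where m: "\<And>f. f \<in> HE_tail m \<Longrightarrow> \<phi> f = \<one>\<^bsub>H\<^esub>"
    unfolding ev by blast
  let ?f = "\<lambda>D W. he (\<lambda>m. HE_proj m D W)"
  have retr: "HE_retr m (x \<otimes>\<^bsub>HE\<^esub> y) = HE_retr m x \<otimes>\<^bsub>HE\<^esub> HE_retr m y" for x y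
    by (simp add: HE_retr_def HE_def)
  \<comment> \<open>On words, the retraction deletes the letters of index above
    \<open>m\<close>.\<close>
  have retr_carrier: "HE_retr m (?f D W) \<in> carrier HE" if "HE_word D W" for D W
  proof -
    let ?D = "{i \<in> D. fst (W i) \<le> m}"
    have "{i \<in> ?D. fst (W i) \<le> k} = {i \<in> D. fst (W i) \<le> min k m}" for k by auto
    then have "HE_retr m (?f D W) = ?f ?D W"
      by (simp add: HE_retr_def he_def HE_proj_def fun_eq_iff)
    moreover have "HE_word ?D W" using that by (rule HE_word_subset) auto
    ultimately show ?thesis by (simp add: coherent_HE_proj)
  qed
  have main: "\<phi> (?f D W) = \<phi> (HE_retr m (?f D W))" if "HE_word D W" for D W
    using that
  proof (induction "card {i \<in> D. fst (W i) \<le> m}" arbitrary: D)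
    case 0
    then have "{i \<in> D. fst (W i) \<le> m} = {}" by (simp add: HE_word_def)
    then have "m < fst (W i)" if "i \<in> D" for i using that by force
    then have Nil: "HE_proj j D W = []" if "j \<le> m" for j
      using HE_proj_eq_Nil that by blast
    then have "?f D W \<in> HE_tail m"
      using coherent_HE_proj[OF 0(2)] by (auto simp: HE_tail_def)
    moreover have "HE_retr m (?f D W) = \<one>\<^bsub>HE\<^esub>"
      using Nil by (simp add: HE_retr_def he_def one_HE fun_eq_iff)
    ultimately show ?case using m by simp
  next
    case (Suc c)
    let ?A = "{i \<in> D. fst (W i) \<le> m}"
    \<comment> \<open>The cut is at the leftmost letter of index at most \<open>m\<close>: what
      precedes it lies in \<open>HE_tail m\<close>, the letter itself is fixed by
      \<open>HE_retr m\<close>, and what follows has one such letter fewer.\<close>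
    define q where "q = Min ?A"
    have "finite ?A" using Suc.prems by (simp add: HE_word_def)
    moreover have "?A \<noteq> {}" using Suc.hyps(2) by fastforce
    ultimately have q: "q \<in> ?A" "\<And>i. i \<in> ?A \<Longrightarrow> q \<le> i"
      using Min_in Min_le unfolding q_def by blast+
    let ?D1 = "D \<inter> {..<q}" and ?D2 = "D \<inter> {q<..}"
    have D: "D = ?D1 \<union> ({q} \<union> ?D2)" using q(1) by auto
    have sub: "HE_word D' W" if "D' \<subseteq> D" for D'
      using HE_word_subset[OF Suc.prems that] .
    have W: "HE_word ?D1 W" "HE_word {q} W" "HE_word ?D2 W" "HE_word ({q} \<union> ?D2) W"
      using q(1) by (auto intro!: sub)
    have "HE_word (?D1 \<union> ({q} \<union> ?D2)) W"
      by (subst D[symmetric]) (rule Suc.prems)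
    then have "HE_proj j (?D1 \<union> ({q} \<union> ?D2)) W = HE_proj j ?D1 W @ HE_proj j {q} W @ HE_proj j ?D2 W" for j
      using W(4) by (subst HE_proj_Un, simp, fastforce) (subst HE_proj_Un, auto)
    then have "HE_proj j D W = HE_proj j ?D1 W @ HE_proj j {q} W @ HE_proj j ?D2 W" for j
      by (subst D)
    then have f: "?f D W = ?f ?D1 W \<otimes>\<^bsub>HE\<^esub> (?f {q} W \<otimes>\<^bsub>HE\<^esub> ?f ?D2 W)"
      unfolding mult_he by simp
    have "fst (W i) > m" if "i \<in> ?D1" for i
      using q(2)[of i] that by force
    then have Nil: "HE_proj j ?D1 W = []" if "j \<le> m" for j
      using HE_proj_eq_Nil that by blast
    then have "?f ?D1 W \<in> HE_tail m"
      using coherent_HE_proj[OF W(1)] by (auto simp: HE_tail_def)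
    then have 1: "\<phi> (?f ?D1 W) = \<one>\<^bsub>H\<^esub>" by (rule m)
    have retr1: "HE_retr m (?f ?D1 W) = \<one>\<^bsub>HE\<^esub>"
      using Nil by (simp add: HE_retr_def he_def one_HE fun_eq_iff)
    have 2: "HE_retr m (?f {q} W) = ?f {q} W"
    proof -
      have "{i \<in> {q}. fst (W i) \<le> k} = {i \<in> {q}. fst (W i) \<le> min k m}" for k
        using q(1) by auto
      then show ?thesis by (simp add: HE_retr_def he_def HE_proj_def fun_eq_iff)
    qed
    have "{i \<in> ?D2. fst (W i) \<le> m} = ?A - {q}"
      using q by force
    then have "c = card {i \<in> ?D2. fst (W i) \<le> m}"
      using Suc.hyps(2) q(1) \<open>finite ?A\<close> by simp
    then have 3: "\<phi> (?f ?D2 W) = \<phi> (HE_retr m (?f ?D2 W))"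
      using Suc.hyps(1) W(3) by blast
    show ?case
      unfolding f retr retr1 2 using W retr_carrier[OF W(3)]
      by (simp add: 1 3 coherent_HE_proj)
  qed
  show "\<exists>m. \<forall>x\<in>carrier HE. \<phi> x = \<phi> (HE_retr m x)"
  proof (intro exI ballI)
    fix x assume "x \<in> carrier HE"
    then obtain D W where "HE_word D W" "x = ?f D W"
      by (auto simp: HE_def HE_carrier_def he_def fun_eq_iff)
    then show "\<phi> x = \<phi> (HE_retr m x)" using main by simp
  qed
qed

theorem theoremA:
  fixes H :: "('a, 'm) monoid_scheme"
  assumes "aleph1_free H"
  shows "n_slender H \<and> cm_slender TYPE('b) H \<and> lcH_slender TYPE('c) H
    \<and> (\<forall>(G :: 'b monoid) T \<phi>. topological_group G T \<and> completely_metrizable_space T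
          \<and> \<phi> \<in> hom G H \<longrightarrow> openin T (kernel G H \<phi>))
    \<and> (\<forall>(G :: 'c monoid) T \<phi>. topological_group G T \<and> locally_compact_space T
          \<and> Hausdorff_space T \<and> \<phi> \<in> hom G H \<longrightarrow> openin T (kernel G H \<phi>))"
  using aleph1_free_n_slender[OF assms] aleph1_free_cm_slender[OF assms, where 'b = 'b]
    aleph1_free_lcH_slender[OF assms, where 'b = 'c]
  unfolding cm_slender_def lcH_slender_def by blast

end
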